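(* Let $\mu>-1/2$. 1. For all $g\in\mathcal{B}^2_{e,\mu}$, the entropy $S_{L^2(\nu_{e,\mu})}(g)$ is finite if and only if the Dirichlet energy $\|D_\mu g\|^2_{\mathcal{B}^2_\mu}$ is finite. 2. For all $h\in\mathcal{B}^2_{o,\mu}$, the entropy $S_{L^2(\nu_{o,\mu})}(h)$ is finite if and only if the Dirichlet energy $\|D_\mu h\|^2_{\mathcal{B}^2_\mu}$ is finite. 3. For all $f\in\mathcal{B}^2_\mu$, the $\mu$-deformed entropy $S_\mu(f)$ is finite if and only if the Dirichlet energy $\|D_\mu f\|^2_{\mathcal{B}^2_\mu}$ is finite.
   Context: Fix $\mu>-1/2$. For $x>0$ and $\alpha\in\mathbf{R}$, $K_\alpha(x)=\int_0^\infty e^{-x\cosh u}\cosh(\alpha u)\,du$ is the Macdonald function. On $\mathbf{C}$ define the finite measures $d\nu_{e,\mu}(z)=\nu_{e,\mu}(z)\,dx\,dy$ and $d\nu_{o,\mu}(z)=\nu_{o,\mu}(z)\,dx\,dy$ with densities, for $z\neq0$, $$\nu_{e,\mu}(z)=\frac{2^{\frac12-\mu}}{\pi\Gamma(\mu+\frac12)}K_{\mu-\frac12}(|z|^2)|z|^{2\mu+1},\qquad \nu_{o,\mu}(z)=\frac{2^{\frac12-\mu}}{\pi\Gamma(\mu+\frac12)}K_{\mu+\frac12}(|z|^2)|z|^{2\mu+1}.$$ For $f:\mathbf{C}\to\mathbf{C}$, $f_e(z)=(f(z)+f(-z))/2$ and $f_o(z)=(f(z)-f(-z))/2$ are its even and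 odd parts. $\mathcal{B}^2_\mu$ is the space of entire functions $f$ with $f_e\in L^2(\mathbf{C},\nu_{e,\mu})$ and $f_o\in L^2(\mathbf{C},\nu_{o,\mu})$, with norm $\|f\|^2_{\mathcal{B}^2_\mu}=\|f_e\|^2_{L^2(\nu_{e,\mu})}+\|f_o\|^2_{L^2(\nu_{o,\mu})}$; $\mathcal{B}^2_{e,\mu}$ and $\mathcal{B}^2_{o,\mu}$ are its subspaces of even and odd functions. Entropy: for a finite measure space $(\Omega,\nu)$ and $f\in L^2(\Omega,\nu)$, $S_{L^2(\Omega,\nu)}(f)=\int_\Omega|f|^2\log|f|^2\,d\nu-\|f\|^2_{L^2}\log\|f\|^2_{L^2}\in(-\infty,+\infty]$, with $0\log0=0$. Let $\mathbf{Z}_2=\{-1,+1\}$ and let $\nu_\mu$ be the measure on $\mathbf{C}\times\mathbf{Z}_2$ equal to $\nu_{e,\mu}$ on $\mathbf{C}\times\{+1\}$ and to $\nu_{o,\mu}$ on $\mathbf{C}\times\{-1\}$. The $\mu$-deformed entropy of $f\in\mathcal{B}^2_\mu$ is $S_\mu(f)=S_{L^2(\mathbf{C}\times\mathbf{Z}_2,\nu_\mu)}(f_e,f_o)$, where $(f_e,f_o)$ denotes the function equal to $f_e$ on $\mathbf{C}\times\{+1\}$ and to $f_o$ on $\mathbf{C}\times\{-1\}$. For an entire function $f$, $D_\mu f(z)=f'(z)+\frac{\mu}{z}(f(z)-f(-z))$ (removable singularity at $0$). The Dirichlet energy of $f\in\mathcal{B}^2_\mu$ is $\|D_\mu f\|^2_{\mathcal{B}^2_\mu}$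 if $D_\mu f\in\mathcal{B}^2_\mu$ and $+\infty$ otherwise. *)

theory Defs
  imports "HOL-Complex_Analysis.Complex_Analysis"
begin

definition macdonald :: "real \<Rightarrow> real \<Rightarrow> real" where
  "macdonald \<alpha> x = (LINT u:{0..}|lborel. exp (- x * cosh u) * cosh (\<alpha> * u))"

(* The values at z = 0 produced by these formulas are immaterial, {0} being a null set. *)
definition nu_even_density :: "real \<Rightarrow> complex \<Rightarrow> real" where
  "nu_even_density \<mu> z = 2 powr (1/2 - \<mu>) / (pi * Gamma (\<mu> + 1/2))
     * macdonald (\<mu> - 1/2) ((cmod z)\<^sup>2) * cmod z powr (2 * \<mu> + 1)"

definition nu_odd_density :: "real \<Rightarrow> complex \<Rightarrow> real" where
  "nu_odd_density \<mu> z = 2 powr (1/2 - \<mu>) / (pi * Gamma (\<mu> + 1/2))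
     * macdonald (\<mu> + 1/2) ((cmod z)\<^sup>2) * cmod z powr (2 * \<mu> + 1)"

(* lborel on the Euclidean space complex is dx dy. *)
definition nu_even :: "real \<Rightarrow> complex measure" where
  "nu_even \<mu> = density lborel (\<lambda>z. ennreal (nu_even_density \<mu> z))"

definition nu_odd :: "real \<Rightarrow> complex measure" where
  "nu_odd \<mu> = density lborel (\<lambda>z. ennreal (nu_odd_density \<mu> z))"

(* C x Z_2, with Z_2 = {-1, 1}, carries Lebesgue measure times counting measure; the density
   makes the slice over 1 equal to nu_even and the slice over -1 equal to nu_odd. *)
definition nu_Z2 :: "real \<Rightarrow> (complex \<times> int) measure" where
  "nu_Z2 \<mu> = density (lborel \<Otimes>\<^sub>M count_space {-1, 1})
     (\<lambda>(z, s). ennreal (if s = 1 then nu_even_density \<mu> z else nu_odd_density \<mu> z))"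

definition even_part :: "(complex \<Rightarrow> complex) \<Rightarrow> complex \<Rightarrow> complex" where
  "even_part f z = (f z + f (- z)) / 2"

definition odd_part :: "(complex \<Rightarrow> complex) \<Rightarrow> complex \<Rightarrow> complex" where
  "odd_part f z = (f z - f (- z)) / 2"

definition in_L2 :: "'a measure \<Rightarrow> ('a \<Rightarrow> complex) \<Rightarrow> bool" where
  "in_L2 M f \<longleftrightarrow> f \<in> borel_measurable M \<and> integrable M (\<lambda>x. (cmod (f x))\<^sup>2)"

definition L2_norm :: "'a measure \<Rightarrow> ('a \<Rightarrow> complex) \<Rightarrow> real" where
  "L2_norm M f = sqrt (LINT x|M. (cmod (f x))\<^sup>2)"

definition bargmann_space :: "real \<Rightarrow> (complex \<Rightarrow> complex) set" where
  "bargmann_space \<mu> = {f. f holomorphic_on UNIV \<and>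
     in_L2 (nu_even \<mu>) (even_part f) \<and> in_L2 (nu_odd \<mu>) (odd_part f)}"

definition bargmann_even :: "real \<Rightarrow> (complex \<Rightarrow> complex) set" where
  "bargmann_even \<mu> = {f \<in> bargmann_space \<mu>. \<forall>z. f (- z) = f z}"

definition bargmann_odd :: "real \<Rightarrow> (complex \<Rightarrow> complex) set" where
  "bargmann_odd \<mu> = {f \<in> bargmann_space \<mu>. \<forall>z. f (- z) = - f z}"

definition bargmann_norm :: "real \<Rightarrow> (complex \<Rightarrow> complex) \<Rightarrow> real" where
  "bargmann_norm \<mu> f =
     sqrt ((L2_norm (nu_even \<mu>) (even_part f))\<^sup>2 + (L2_norm (nu_odd \<mu>) (odd_part f))\<^sup>2)"

(* The extended integral of |f|^2 log |f|^2 is the integral of its positive part minus that of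
   its negative part. As t log t >= -1/e, the latter is finite on a finite measure space, so
   the difference is never infinity minus infinity there. 0 log 0 = 0 holds in HOL. *)
definition entropy_L2 :: "'a measure \<Rightarrow> ('a \<Rightarrow> complex) \<Rightarrow> ereal" where
  "entropy_L2 M f =
     enn2ereal (\<integral>\<^sup>+x. ennreal ((cmod (f x))\<^sup>2 * ln ((cmod (f x))\<^sup>2)) \<partial>M)
   - enn2ereal (\<integral>\<^sup>+x. ennreal (- ((cmod (f x))\<^sup>2 * ln ((cmod (f x))\<^sup>2))) \<partial>M)
   - ereal ((L2_norm M f)\<^sup>2 * ln ((L2_norm M f)\<^sup>2))"

definition deformed_entropy :: "real \<Rightarrow> (complex \<Rightarrow> complex) \<Rightarrow> ereal" where
  "deformed_entropy \<mu> f =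
     entropy_L2 (nu_Z2 \<mu>) (\<lambda>(z, s). if s = 1 then even_part f z else odd_part f z)"

definition deformed_deriv :: "real \<Rightarrow> (complex \<Rightarrow> complex) \<Rightarrow> complex \<Rightarrow> complex" where
  "deformed_deriv \<mu> f =
     remove_sings (\<lambda>z. deriv f z + complex_of_real \<mu> / z * (f z - f (- z)))"

definition dirichlet_energy :: "real \<Rightarrow> (complex \<Rightarrow> complex) \<Rightarrow> ereal" where
  "dirichlet_energy \<mu> f =
     (if deformed_deriv \<mu> f \<in> bargmann_space \<mu>
      then ereal ((bargmann_norm \<mu> (deformed_deriv \<mu> f))\<^sup>2) else \<infinity>)"

end

theory Submission
  imports Defs
begin

text \<open>For \<open>f\<close> in the space, both the finiteness of the entropy of a parity part and the finiteness of
  its Dirichlet energy are equivalent to \<open>z f(z)\<close> being square integrable. If the entropy is finite,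
  so is the integral of \<open>|z f(z)|\<^sup>2\<close>, by Young's inequality
  \<open>s t \<le> s ln s - s + exp t\<close> with \<open>s = |f(z)|\<^sup>2\<close>, \<open>t = |z|\<^sup>2 / 2\<close>, because \<open>exp (|z|\<^sup>2 / 2)\<close> is
  integrable; the converse holds since the sub-mean value property gives
  \<open>ln |f(z)|\<^sup>2 \<le> A + B |z|\<^sup>2\<close>. For the energy, monomials are orthogonal for radial measures and the
  moments \<open>e\<^sub>n\<close>, \<open>o\<^sub>n\<close> of \<open>|z|\<^sup>2\<^sup>n\<close> under the two measures satisfy \<open>o\<^sub>n\<^sub>+\<^sub>1 = (n + 1 + 2\<mu>) e\<^sub>n\<close> and
  \<open>e\<^sub>n\<^sub>+\<^sub>1 = (n + 1) o\<^sub>n\<close>. Hence the energy of a parity part agrees, up to multiples of its squared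
  norm, with the integral of \<open>|z f(z)|\<^sup>2\<close> against the measure of the opposite parity, and the two
  measures are comparable off the unit disc.\<close>

section \<open>Radial integrals of entire functions\<close>

lemma nn_integral_lborel_shift:
  fixes c :: "'a::euclidean_space"
  assumes [measurable]: "f \<in> borel_measurable borel"
  shows "(\<integral>\<^sup>+x. f (c + x) \<partial>lborel) = (\<integral>\<^sup>+x. f x \<partial>lborel)"
proof -
  have "(\<integral>\<^sup>+x. f x \<partial>lborel) = (\<integral>\<^sup>+x. f x \<partial>distr lborel borel ((+) c))"
    by (simp add: lborel_distr_plus)
  then show ?thesis by (simp add: nn_integral_distr)
qed

text \<open>The uniqueness argument for Haar measure: integrate against the indicator of the unit ball,
  whose translates all have the same mass and which \<open>T\<close> preserves, and exchange the integrals.\<close>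

lemma nn_integral_lborel_orthogonal:
  fixes T :: "'a::euclidean_space \<Rightarrow> 'a"
  assumes T: "orthogonal_transformation T" and [measurable]: "f \<in> borel_measurable borel"
  shows "(\<integral>\<^sup>+x. f (T x) \<partial>lborel) = (\<integral>\<^sup>+x. f x \<partial>lborel)"
proof -
  define B where "B = (ball 0 1 :: 'a set)"
  define V where "V = emeasure lborel B"
  have Tlin: "linear T" and Tnorm: "\<And>x. norm (T x) = norm x"
    using T by (auto simp: orthogonal_transformation)
  have [measurable]: "T \<in> borel_measurable borel"
    by (intro borel_measurable_continuous_onI linear_continuous_on linear_conv_bounded_linear[THEN iffD1] Tlin)
  have [measurable]: "B \<in> sets borel" by (simp add: B_def)
  have surj: "surj T" using T by (simp add: orthogonal_transformation_surj)
  have V: "V \<noteq> 0" "V \<noteq> \<infinity>"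
    by (auto simp: V_def B_def emeasure_ball unit_ball_vol_def Gamma_eq_zero_iff)
  have "V * (\<integral>\<^sup>+x. f (T x) \<partial>lborel) = (\<integral>\<^sup>+y. indicator B y * (\<integral>\<^sup>+x. f (T x) \<partial>lborel) \<partial>lborel)"
    by (simp add: V_def nn_integral_multc)
  also have "\<dots> = (\<integral>\<^sup>+y. (\<integral>\<^sup>+x. indicator B y * f (y + T x) \<partial>lborel) \<partial>lborel)"
  proof (rule nn_integral_cong)
    fix y
    \<comment> \<open>Writing \<open>y\<close> as \<open>T w\<close> turns the translation of the
      image by \<open>y\<close> into a translation of the argument by \<open>w\<close>, to which
      \<open>nn_integral_lborel_shift\<close> applies.\<close>
    obtain w where w: "y = T w" using surj by (meson surjD)
    have "(\<integral>\<^sup>+x. f (T x) \<partial>lborel) = (\<integral>\<^sup>+x. f (T (w + x)) \<partial>lborel)"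
      by (subst nn_integral_lborel_shift[where f = "\<lambda>x. f (T x)"]) auto
    then show "indicator B y * (\<integral>\<^sup>+x. f (T x) \<partial>lborel) = (\<integral>\<^sup>+x. indicator B y * f (y + T x) \<partial>lborel)"
      by (simp add: nn_integral_cmult w linear_add[OF Tlin])
  qed
  also have "\<dots> = (\<integral>\<^sup>+x. (\<integral>\<^sup>+y. indicator B y * f (y + T x) \<partial>lborel) \<partial>lborel)"
    by (rule lborel_pair.Fubini') measurable
  also have "\<dots> = (\<integral>\<^sup>+x. (\<integral>\<^sup>+y. indicator B (y - T x) * f y \<partial>lborel) \<partial>lborel)"
  proof (rule nn_integral_cong)
    fix x
    show "(\<integral>\<^sup>+y. indicator B y * f (y + T x) \<partial>lborel) = (\<integral>\<^sup>+y. indicator B (y - T x) * f y \<partial>lborel)"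
      using nn_integral_lborel_shift[of "\<lambda>y. indicator B (y - T x) * f y" "T x"]
      by (simp add: add.commute)
  qed
  also have "\<dots> = (\<integral>\<^sup>+y. (\<integral>\<^sup>+x. indicator B (y - T x) * f y \<partial>lborel) \<partial>lborel)"
    by (rule lborel_pair.Fubini') measurable
  also have "\<dots> = (\<integral>\<^sup>+y. V * f y \<partial>lborel)"
  proof (rule nn_integral_cong)
    fix y
    obtain w where w: "y = T w" using surj by (meson surjD)
    have ball: "ball w 1 \<in> sets (lborel :: 'a measure)" by simp
    \<comment> \<open>Here \<open>y - T x = T (w - x)\<close> and \<open>T\<close> preserves norms,
      so the condition becomes membership of \<open>x\<close> in \<open>ball w 1\<close>, whose mass
      does not depend on \<open>w\<close>.\<close>
    have ind: "indicator B (y - T x) = (indicator (ball w 1) x :: ennreal)" for x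
      by (auto simp: indicator_def B_def dist_norm w linear_diff[OF Tlin, symmetric] Tnorm)
    have "(\<integral>\<^sup>+x. indicator B (y - T x) * f y \<partial>lborel) = emeasure lborel (ball w 1) * f y"
      unfolding ind by (subst nn_integral_multc) (simp_all only: nn_integral_indicator[OF ball] borel_measurable_indicator[OF ball])
    also have "emeasure lborel (ball w 1) = V"
      by (simp add: V_def B_def emeasure_ball)
    finally show "(\<integral>\<^sup>+x. indicator B (y - T x) * f y \<partial>lborel) = V * f y" .
  qed
  also have "\<dots> = V * (\<integral>\<^sup>+y. f y \<partial>lborel)" by (simp add: nn_integral_cmult)
  finally show ?thesis using V by (simp add: ennreal_mult_cancel_left)
qed

text \<open>A disc of squared radius \<open>a\<close> has area \<open>pi * a\<close>, so both
  measures agree on the half-lines \<open>{..a}\<close>, an intersection-stable generator. The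
  squared modulus is used because area then has constant density and because it is the argument of
  the Macdonald functions.\<close>

lemma distr_cmod_square:
  "distr lborel borel (\<lambda>z::complex. (cmod z)\<^sup>2) = density lborel (\<lambda>x. ennreal pi * indicator {0..} x)"
proof (rule measure_eqI_generator_eq[where E="range (\<lambda>a::real. {..a})" and \<Omega>=UNIV and A="\<lambda>n. {..real n}"])
  show "Int_stable (range (\<lambda>a::real. {..a}))"
    by (auto simp: Int_stable_def)
  have eq1: "emeasure (distr lborel borel (\<lambda>z::complex. (cmod z)\<^sup>2)) {..a} = ennreal (pi * max 0 a)" for a
  proof (cases "a \<ge> 0")
    case True
    have "(\<lambda>z::complex. (cmod z)\<^sup>2) -` {..a} = cball 0 (sqrt a)"
      using True by (auto simp: real_le_rsqrt real_sqrt_le_iff) (metis norm_ge_zero real_le_rsqrt real_sqrt_pow2 power_mono)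
    then show ?thesis using True
      by (simp add: emeasure_distr emeasure_cball unit_ball_vol_2)
  next
    case False
    then have "\<not> (cmod z)\<^sup>2 \<le> a" for z
      using zero_le_power2[of "cmod z"] by linarith
    then have "(\<lambda>z::complex. (cmod z)\<^sup>2) -` {..a} = {}"
      by auto
    then show ?thesis using False by (simp add: emeasure_distr)
  qed
  have eq2: "emeasure (density lborel (\<lambda>x. ennreal pi * indicator {0..} x)) {..a} = ennreal (pi * max 0 a)" for a
  proof -
    have "emeasure (density lborel (\<lambda>x. ennreal pi * indicator {0..} x)) {..a} =
        (\<integral>\<^sup>+x. ennreal pi * indicator {0..a} x \<partial>lborel)"
      by (auto simp: emeasure_density indicator_def intro!: nn_integral_cong)
    also have "\<dots> = ennreal pi * emeasure lborel {0..a}" by (simp add: nn_integral_cmult)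
    finally show ?thesis by (cases "a \<ge> 0") (auto simp: ennreal_mult'' max_def)
  qed
  show "emeasure (distr lborel borel (\<lambda>z::complex. (cmod z)\<^sup>2)) X =
      emeasure (density lborel (\<lambda>x. ennreal pi * indicator {0..} x)) X" if "X \<in> range (\<lambda>a. {..a})" for X
    using that by (auto simp: eq1 eq2)
  show "emeasure (distr lborel borel (\<lambda>z::complex. (cmod z)\<^sup>2)) {..real n} \<noteq> \<infinity>" for n
    by (simp add: eq1)
  show "(\<Union>n. {..real n}) = UNIV" by (auto intro: real_arch_simple)
qed (auto simp: borel_eq_atMost)

lemma nn_integral_complex_radial:
  assumes [measurable]: "g \<in> borel_measurable borel"
  shows "(\<integral>\<^sup>+z. g ((cmod z)\<^sup>2) \<partial>lborel) = ennreal pi * (\<integral>\<^sup>+x. indicator {0..} x * g x \<partial>lborel)"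
proof -
  have "(\<integral>\<^sup>+z. g ((cmod z)\<^sup>2) \<partial>lborel) = (\<integral>\<^sup>+x. g x \<partial>distr lborel borel (\<lambda>z::complex. (cmod z)\<^sup>2))"
    by (simp add: nn_integral_distr)
  also have "\<dots> = (\<integral>\<^sup>+x. ennreal pi * (indicator {0..} x * g x) \<partial>lborel)"
    by (simp add: distr_cmod_square nn_integral_density mult.assoc)
  finally show ?thesis by (simp add: nn_integral_cmult)
qed

section \<open>Orthogonality and Parseval on the circle\<close>

lemma has_integral_cis_period:
  fixes k :: int
  shows "((\<lambda>t. cis (of_int k * t)) has_integral (if k = 0 then 2 * pi else 0)) {0..2*pi}"
proof (cases "k = 0")
  case True
  then show ?thesis using has_integral_const_real[of "1::complex" 0 "2*pi"] by (simp add: scaleR_conv_of_real)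
next
  case False
  let ?F = "\<lambda>t. cis (of_int k * t) / (\<i> * of_int k)"
  have "((\<lambda>t. cis (of_int k * t)) has_integral (?F (2*pi) - ?F 0)) {0..2*pi}"
    by (rule fundamental_theorem_of_calculus)
       (auto intro!: derivative_eq_intros simp: has_vector_derivative_def False fun_eq_iff scaleR_conv_of_real algebra_simps)
  moreover have "cis (of_int k * (2*pi)) = 1"
    by (metis Ints_of_int cis_multiple_2pi mult.commute)
  ultimately show ?thesis using False by simp
qed

text \<open>Orthogonality of the exponentials leaves only the diagonal of the double sum. The
  computation is complex valued, and real parts are taken at the end.\<close>

lemma has_integral_trig_polynomial_square:
  fixes b :: "nat \<Rightarrow> complex"
  shows "((\<lambda>t. (cmod (\<Sum>n<N. b n * cis (real n * t)))\<^sup>2) has_integral (\<Sum>n<N. 2 * pi * (cmod (b n))\<^sup>2)) {0..2*pi}"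
proof -
  have "((\<lambda>t. \<Sum>n<N. \<Sum>m<N. b n * cnj (b m) * cis (of_int (int n - int m) * t)) has_integral
         (\<Sum>n<N. \<Sum>m<N. b n * cnj (b m) * (if int n - int m = 0 then 2 * pi else 0))) {0..2*pi}"
    by (intro has_integral_sum has_integral_mult_right has_integral_cis_period) auto
  also have "(\<lambda>t. \<Sum>n<N. \<Sum>m<N. b n * cnj (b m) * cis (of_int (int n - int m) * t)) =
      (\<lambda>t. complex_of_real ((cmod (\<Sum>n<N. b n * cis (real n * t)))\<^sup>2))"
    unfolding complex_norm_square cnj_sum sum_product
    by (auto simp: fun_eq_iff cis_cnj cis_mult algebra_simps intro!: sum.cong)
  also have "(\<Sum>n<N. \<Sum>m<N. b n * cnj (b m) * (if int n - int m = 0 then 2 * pi else 0)) =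
      complex_of_real (\<Sum>n<N. 2 * pi * (cmod (b n))\<^sup>2)"
  proof -
    have "(\<Sum>m<N. b n * cnj (b m) * (if int n - int m = 0 then 2 * pi else 0)) =
        complex_of_real (2 * pi * (cmod (b n))\<^sup>2)" if "n < N" for n
    proof -
      have "(\<Sum>m<N. b n * cnj (b m) * (if int n - int m = 0 then 2 * pi else 0)) =
          (\<Sum>m<N. if m = n then b n * cnj (b n) * (2 * pi) else 0)"
        by (intro sum.cong) auto
      also have "\<dots> = complex_of_real (2 * pi * (cmod (b n))\<^sup>2)"
        using that by (simp add: complex_norm_square del: of_real_power)
      finally show ?thesis .
    qed
    then show ?thesis by simp
  qed
  finally show ?thesis
    by (drule_tac has_integral_linear[OF _ bounded_linear_Re]) (simp only: o_def Re_complex_of_real)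
qed

text \<open>Dominated convergence from trigonometric polynomials: absolute summability bounds all
  partial sums, uniformly in \<open>t\<close>, by the constant
  \<open>\<Sum>n. norm (b n)\<close>.\<close>

lemma circle_parseval:
  fixes b :: "nat \<Rightarrow> complex"
  assumes b: "summable (\<lambda>n. norm (b n))"
  shows "(\<integral>\<^sup>+t. indicator {0..2*pi} t * ennreal ((cmod (\<Sum>n. b n * cis (real n * t)))\<^sup>2) \<partial>lborel)
    = ennreal (2 * pi) * (\<Sum>n. ennreal ((cmod (b n))\<^sup>2))"
proof -
  have sm: "summable (\<lambda>n. b n * cis (real n * t))" for t
    by (rule summable_norm_cancel) (simp add: norm_mult b)
  have partial_le: "cmod (\<Sum>n<N. b n * cis (real n * t)) \<le> (\<Sum>n. norm (b n))" for N t
  proof -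
    have "cmod (\<Sum>n<N. b n * cis (real n * t)) \<le> (\<Sum>n<N. norm (b n))"
      by (rule norm_sum[THEN order_trans]) (simp add: norm_mult)
    also have "\<dots> \<le> (\<Sum>n. norm (b n))" by (rule sum_le_suminf[OF b]) auto
    finally show ?thesis .
  qed
  have sq: "summable (\<lambda>n. (cmod (b n))\<^sup>2)"
  proof (rule summable_comparison_test_ev[OF _ b])
    have "eventually (\<lambda>n. norm (b n) < 1) sequentially"
      using summable_LIMSEQ_zero[OF b] by (rule order_tendstoD) simp
    then show "eventually (\<lambda>n. norm ((cmod (b n))\<^sup>2) \<le> norm (b n)) sequentially"
      by eventually_elim (simp add: power2_eq_square mult_left_le)
  qed
  have "((\<lambda>t. (cmod (\<Sum>n. b n * cis (real n * t)))\<^sup>2) has_integral (\<Sum>n. 2 * pi * (cmod (b n))\<^sup>2)) {0..2*pi}"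
  proof (rule has_integral_dominated_convergence)
    show "\<And>N. ((\<lambda>t. (cmod (\<Sum>n<N. b n * cis (real n * t)))\<^sup>2) has_integral (\<Sum>n<N. 2 * pi * (cmod (b n))\<^sup>2)) {0..2*pi}"
      by (rule has_integral_trig_polynomial_square)
    show "(\<lambda>_. (\<Sum>n. norm (b n))\<^sup>2) integrable_on {0..2*pi}" by (rule integrable_const_ivl)
    show "\<And>N. \<forall>t\<in>{0..2*pi}. norm ((cmod (\<Sum>n<N. b n * cis (real n * t)))\<^sup>2) \<le> (\<Sum>n. norm (b n))\<^sup>2"
      by (auto intro!: power_mono partial_le)
    show "\<forall>t\<in>{0..2*pi}. (\<lambda>N. (cmod (\<Sum>n<N. b n * cis (real n * t)))\<^sup>2) \<longlonglongrightarrow> (cmod (\<Sum>n. b n * cis (real n * t)))\<^sup>2"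
      by (auto intro!: tendsto_intros summable_LIMSEQ sm)
    show "(\<lambda>N. \<Sum>n<N. 2 * pi * (cmod (b n))\<^sup>2) \<longlonglongrightarrow> (\<Sum>n. 2 * pi * (cmod (b n))\<^sup>2)"
      by (intro summable_LIMSEQ summable_mult sq)
  qed
  from nn_integral_has_integral_lebesgue[OF _ this]
  have "(\<integral>\<^sup>+t. indicator {0..2*pi} t * ennreal ((cmod (\<Sum>n. b n * cis (real n * t)))\<^sup>2) \<partial>lborel)
    = ennreal (\<Sum>n. 2 * pi * (cmod (b n))\<^sup>2)"
    by (simp add: ennreal_mult'' ennreal_indicator)
  also have "\<dots> = ennreal (2 * pi) * (\<Sum>n. ennreal ((cmod (b n))\<^sup>2))"
  proof -
    have "(\<Sum>n. ennreal ((cmod (b n))\<^sup>2)) = ennreal (\<Sum>n. (cmod (b n))\<^sup>2)"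
      by (rule suminf_ennreal2) (simp_all add: sq)
    then show ?thesis
      by (simp only: suminf_mult[OF sq] ennreal_mult'' suminf_nonneg[OF sq] zero_le_power2)
  qed
  finally show ?thesis .
qed

text \<open>Convergence at the real point \<open>norm z + 1\<close>, strictly farther from the
  origin than \<open>z\<close>, forces absolute convergence at \<open>z\<close>. This is the
  hypothesis of \<open>circle_parseval\<close>.\<close>

lemma summable_norm_entire_power_series:
  fixes f :: "complex \<Rightarrow> complex"
  assumes "\<And>z. (\<lambda>n. a n * z ^ n) sums f z"
  shows "summable (\<lambda>n. norm (a n * z ^ n))"
  by (rule powser_insidea[of a "of_real (norm z + 1)"]) (use assms sums_summable in auto)

text \<open>Averaging over rotations of the plane replaces polar coordinates.\<close>

lemma nn_integral_radial_power_series: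
  fixes \<phi> :: "real \<Rightarrow> ennreal" and f :: "complex \<Rightarrow> complex"
  assumes [measurable]: "\<phi> \<in> borel_measurable borel"
    and f: "\<And>z. (\<lambda>n. a n * z ^ n) sums f z"
  shows "(\<integral>\<^sup>+z. \<phi> (cmod z) * ennreal ((cmod (f z))\<^sup>2) \<partial>lborel) =
    (\<Sum>n. ennreal ((cmod (a n))\<^sup>2) * (\<integral>\<^sup>+z. \<phi> (cmod z) * ennreal (cmod z ^ (2 * n)) \<partial>lborel))"
proof -
  have fe: "f = (\<lambda>z. \<Sum>n. a n * z ^ n)" using f by (auto simp: sums_iff)
  have [measurable]: "f \<in> borel_measurable borel" unfolding fe by measurable
  have [measurable]: "cis \<in> borel_measurable borel"
    by (intro borel_measurable_continuous_onI continuous_intros)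
  let ?L = "\<integral>\<^sup>+z. \<phi> (cmod z) * ennreal ((cmod (f z))\<^sup>2) \<partial>lborel"
  have rot: "?L = (\<integral>\<^sup>+z. \<phi> (cmod z) * ennreal ((cmod (f (cis t * z)))\<^sup>2) \<partial>lborel)" for t
  proof -
    have "orthogonal_transformation ((*) (cis t))"
      by (auto simp: orthogonal_transformation norm_mult intro!: linearI simp: algebra_simps)
    from nn_integral_lborel_orthogonal[OF this, of "\<lambda>z. \<phi> (cmod z) * ennreal ((cmod (f z))\<^sup>2)"]
    show ?thesis by (simp add: norm_mult)
  qed
  \<comment> \<open>The factor \<open>2 * pi\<close> enters as an integral over the angle
    \<open>t\<close>. After the exchange of integrals the inner one runs over the circle through
    \<open>z\<close>, where \<open>circle_parseval\<close> evaluates it.\<close>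
  have "ennreal (2 * pi) * ?L = (\<integral>\<^sup>+t. indicator {0..2*pi} t * ?L \<partial>lborel)"
    by (simp add: nn_integral_multc)
  also have "\<dots> = (\<integral>\<^sup>+t. (\<integral>\<^sup>+z. indicator {0..2*pi} t * (\<phi> (cmod z) * ennreal ((cmod (f (cis t * z)))\<^sup>2)) \<partial>lborel) \<partial>lborel)"
    by (intro nn_integral_cong) (simp add: nn_integral_cmult flip: rot)
  also have "\<dots> = (\<integral>\<^sup>+z. (\<integral>\<^sup>+t. indicator {0..2*pi} t * (\<phi> (cmod z) * ennreal ((cmod (f (cis t * z)))\<^sup>2)) \<partial>lborel) \<partial>lborel)"
    by (rule lborel_pair.Fubini') measurable
  also have "\<dots> = (\<integral>\<^sup>+z. ennreal (2 * pi) * (\<Sum>n. ennreal ((cmod (a n))\<^sup>2) * (\<phi> (cmod z) * ennreal (cmod z ^ (2 * n)))) \<partial>lborel)"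
  proof (rule nn_integral_cong)
    fix z :: complex
    have "(\<integral>\<^sup>+t. indicator {0..2*pi} t * (\<phi> (cmod z) * ennreal ((cmod (f (cis t * z)))\<^sup>2)) \<partial>lborel)
      = \<phi> (cmod z) * (\<integral>\<^sup>+t. indicator {0..2*pi} t * ennreal ((cmod (\<Sum>n. (a n * z ^ n) * cis (real n * t)))\<^sup>2) \<partial>lborel)"
      by (subst nn_integral_cmult[symmetric])
         (auto simp: fe power_mult_distrib Complex.DeMoivre mult_ac)
    also have "\<dots> = ennreal (2 * pi) * (\<Sum>n. \<phi> (cmod z) * ennreal ((cmod (a n * z ^ n))\<^sup>2))"
      unfolding circle_parseval[OF summable_norm_entire_power_series[OF f]]
      by (simp add: mult_ac)
    also have "(\<lambda>n. \<phi> (cmod z) * ennreal ((cmod (a n * z ^ n))\<^sup>2)) =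
        (\<lambda>n. ennreal ((cmod (a n))\<^sup>2) * (\<phi> (cmod z) * ennreal (cmod z ^ (2 * n))))"
      by (simp add: fun_eq_iff norm_mult norm_power power_mult_distrib ennreal_mult mult_ac flip: power_mult)
    finally show "(\<integral>\<^sup>+t. indicator {0..2*pi} t * (\<phi> (cmod z) * ennreal ((cmod (f (cis t * z)))\<^sup>2)) \<partial>lborel) =
      ennreal (2 * pi) * (\<Sum>n. ennreal ((cmod (a n))\<^sup>2) * (\<phi> (cmod z) * ennreal (cmod z ^ (2 * n))))" .
  qed
  also have "\<dots> = ennreal (2 * pi) * (\<Sum>n. ennreal ((cmod (a n))\<^sup>2) * (\<integral>\<^sup>+z. \<phi> (cmod z) * ennreal (cmod z ^ (2 * n)) \<partial>lborel))"
    by (simp add: nn_integral_cmult nn_integral_suminf)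
  finally show ?thesis by (simp add: ennreal_mult_cancel_left)
qed

section \<open>The Macdonald function and its moments\<close>

text \<open>This is the Mellin transform of \<open>macdonald \<alpha>\<close> at \<open>s\<close>
  divided by \<open>Gamma s\<close>; compare \<open>macdonald_moment\<close>.\<close>

definition cosh_integral :: "real \<Rightarrow> real \<Rightarrow> real" where
  "cosh_integral \<alpha> s = (LINT u:{0..}|lborel. cosh (\<alpha> * u) * cosh u powr (- s))"

lemma cosh_le_exp_abs: "u \<ge> 0 \<Longrightarrow> cosh (\<alpha> * u) \<le> exp (\<bar>\<alpha>\<bar> * u)" for u :: real
proof -
  assume u: "u \<ge> 0"
  have "cosh (\<alpha> * u) = cosh (\<bar>\<alpha>\<bar> * u)" using u by (metis cosh_real_abs abs_mult abs_of_nonneg)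
  also have "\<dots> \<le> exp (\<bar>\<alpha>\<bar> * u)" using u by (simp add: cosh_field_def)
  finally show ?thesis .
qed

lemma cosh_powr_neg_le:
  fixes u s :: real
  assumes "s \<ge> 0"
  shows "cosh u powr (- s) \<le> 2 powr s * exp (- s * u)"
proof -
  have "cosh u \<ge> exp u / 2" by (simp add: cosh_field_def)
  then have "cosh u powr (- s) \<le> (exp u / 2) powr (- s)"
    using assms by (intro powr_mono2') auto
  also have "\<dots> = 2 powr s * exp (- s * u)"
    by (simp add: powr_divide powr_minus exp_powr_real field_simps exp_minus)
  finally show ?thesis .
qed

text \<open>Exponential decay at rate s - |\<alpha>|. It is the source of the threshold s >
  |\<alpha>| for integrability, and it also removes the boundary term at infinity in
  \<open>cosh_integral_Suc\<close>.\<close>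

lemma cosh_product_le:
  fixes u s \<alpha> :: real
  assumes "s \<ge> 0" "u \<ge> 0"
  shows "cosh (\<alpha> * u) * cosh u powr (- s) \<le> 2 powr s * exp (- (s - \<bar>\<alpha>\<bar>) * u)"
proof -
  have "cosh (\<alpha> * u) * cosh u powr (- s) \<le> exp (\<bar>\<alpha>\<bar> * u) * (2 powr s * exp (- s * u))"
    using assms by (intro mult_mono cosh_le_exp_abs cosh_powr_neg_le) auto
  also have "\<dots> = 2 powr s * exp (- (s - \<bar>\<alpha>\<bar>) * u)"
    by (simp add: algebra_simps flip: exp_add)
  finally show ?thesis .
qed

lemma set_integrable_exp_neg:
  assumes "c > 0"
  shows "set_integrable lborel {0..} (\<lambda>u::real. exp (- c * u))"
  unfolding set_integrable_def
proof (rule integrableI_nonneg)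
  have "(\<integral>\<^sup>+u. ennreal (indicator {0..} u * exp (- c * u)) \<partial>lborel) = ennreal (exp (-c*0)/c)"
    using nn_integral_has_integral_lebesgue[OF _ has_integral_exp_minus_to_infinity[OF assms, of 0]] by simp
  then show "(\<integral>\<^sup>+u. ennreal (indicat_real {0..} u *\<^sub>R exp (- c * u)) \<partial>lborel) < \<infinity>"
    by simp
qed auto

lemma borel_measurable_cosh [measurable]: "(cosh :: real \<Rightarrow> real) \<in> borel_measurable borel"
  by (intro borel_measurable_continuous_onI continuous_intros)

lemma set_integrable_cosh_integral:
  fixes \<alpha> s :: real
  assumes "s > \<bar>\<alpha>\<bar>"
  shows "set_integrable lborel {0..} (\<lambda>u. cosh (\<alpha> * u) * cosh u powr (- s))"
proof (rule set_integrable_bound)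
  show "set_integrable lborel {0..} (\<lambda>u. 2 powr s * exp (- (s - \<bar>\<alpha>\<bar>) * u))"
    using assms by (intro set_integrable_mult_right set_integrable_exp_neg) auto
  show "set_borel_measurable lborel {0..} (\<lambda>u. cosh (\<alpha> * u) * cosh u powr (- s))"
    unfolding set_borel_measurable_def by measurable
  show "AE u in lborel. u \<in> {0..} \<longrightarrow> norm (cosh (\<alpha> * u) * cosh u powr (- s)) \<le> norm (2 powr s * exp (- (s - \<bar>\<alpha>\<bar>) * u))"
    using cosh_product_le[of s _ \<alpha>] assms by (auto simp: abs_mult)
qed

text \<open>Raise \<open>y / s \<le> exp (y / s)\<close> to the power \<open>s\<close> and invert.
  The bound trades \<open>exp (- x * cosh u)\<close> for a power of \<open>cosh u\<close>, which
  reduces integrability of the Macdonald integrand to that of \<open>cosh_integral\<close>.\<close>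

lemma exp_minus_le_powr:
  fixes y s :: real
  assumes "y > 0" "s > 0"
  shows "exp (- y) \<le> (y / s) powr (- s)"
proof -
  have "(y / s) powr s \<le> exp (y / s) powr s"
    using assms by (intro powr_mono2) (auto intro: order_trans[OF _ exp_ge_add_one_self])
  also have "\<dots> = exp y" using assms by (simp add: exp_powr_real)
  finally show ?thesis using assms by (simp add: powr_minus exp_minus)
qed

lemma set_integrable_macdonald:
  fixes \<alpha> x :: real
  assumes "x > 0"
  shows "set_integrable lborel {0..} (\<lambda>u. exp (- x * cosh u) * cosh (\<alpha> * u))"
proof (rule set_integrable_bound)
  \<comment> \<open>Any exponent above |\<alpha>| would make the majorant integrable.\<close>
  let ?s = "\<bar>\<alpha>\<bar> + 1"
  show "set_integrable lborel {0..} (\<lambda>u. (x / ?s) powr (- ?s) * (cosh (\<alpha> * u) * cosh u powr (- ?s)))"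
    by (intro set_integrable_mult_right set_integrable_cosh_integral) auto
  show "set_borel_measurable lborel {0..} (\<lambda>u. exp (- x * cosh u) * cosh (\<alpha> * u))"
    unfolding set_borel_measurable_def by measurable
  have "exp (- x * cosh u) * cosh (\<alpha> * u) \<le> (x / ?s) powr (- ?s) * (cosh (\<alpha> * u) * cosh u powr (- ?s))" for u
  proof -
    have "exp (- (x * cosh u)) \<le> (x * cosh u / ?s) powr (- ?s)"
      using assms by (intro exp_minus_le_powr) auto
    also have "\<dots> = ((x / ?s) * cosh u) powr (- ?s)" by simp
    also have "\<dots> = (x / ?s) powr (- ?s) * cosh u powr (- ?s)"
      by (rule powr_mult)
    finally have "exp (- (x * cosh u)) * cosh (\<alpha> * u) \<le> (x / ?s) powr (- ?s) * cosh u powr (- ?s) * cosh (\<alpha> * u)"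
      by (rule mult_right_mono) simp
    then show ?thesis by (simp only: mult_ac minus_mult_left)
  qed
  then show "AE u in lborel. u \<in> {0..} \<longrightarrow> norm (exp (- x * cosh u) * cosh (\<alpha> * u))
      \<le> norm ((x / ?s) powr (- ?s) * (cosh (\<alpha> * u) * cosh u powr (- ?s)))"
    by (auto simp: abs_mult)
qed

lemma macdonald_nonneg: "macdonald \<alpha> x \<ge> 0"
  unfolding macdonald_def set_lebesgue_integral_def by (intro Bochner_Integration.integral_nonneg) auto

lemma borel_measurable_macdonald [measurable]: "macdonald \<alpha> \<in> borel_measurable borel"
  unfolding macdonald_def set_lebesgue_integral_def by measurable

lemma ennreal_macdonald:
  assumes "x > 0"
  shows "ennreal (macdonald \<alpha> x) =
    (\<integral>\<^sup>+u. indicator {0..} u * ennreal (exp (- x * cosh u) * cosh (\<alpha> * u)) \<partial>lborel)"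
  using nn_integral_eq_integral[OF set_integrable_macdonald[OF assms, of \<alpha>, unfolded set_integrable_def]]
  by (simp add: macdonald_def set_lebesgue_integral_def ennreal_mult'' ennreal_indicator)

text \<open>Keep only u in [0,1], where \<open>cosh u \<le> cosh 1\<close>, and use
  \<open>cosh (\<alpha> * u) \<ge> 1\<close>. The bound is uniform in \<alpha>, so it serves both
  for comparing two orders and for bounding the densities from below.\<close>

lemma macdonald_ge:
  assumes "x > 0"
  shows "exp (- x * cosh 1) \<le> macdonald \<alpha> x"
proof -
  have "exp (- x * cosh 1) = (LINT u:{0..1::real}|lborel. exp (- x * cosh 1))"
    by (simp add: set_lebesgue_integral_def)
  also have "\<dots> \<le> (LINT u:{0..}|lborel. exp (- x * cosh u) * cosh (\<alpha> * u))"
    unfolding set_lebesgue_integral_def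
  proof (rule integral_mono)
    show "integrable lborel (\<lambda>u. indicat_real {0..} u *\<^sub>R (exp (- x * cosh u) * cosh (\<alpha> * u)))"
      using set_integrable_macdonald[OF assms] by (simp add: set_integrable_def)
    show "integrable lborel (\<lambda>u::real. indicat_real {0..1} u *\<^sub>R exp (- x * cosh 1))" by simp
    fix u :: real
    have "exp (- x * cosh 1) * 1 \<le> exp (- x * cosh u) * cosh (\<alpha> * u)" if "0 \<le> u" "u \<le> 1"
      using that assms by (intro mult_mono) (auto simp: cosh_real_nonneg_le_iff cosh_real_ge_1)
    then show "indicat_real {0..1} u *\<^sub>R exp (- x * cosh 1) \<le> indicat_real {0..} u *\<^sub>R (exp (- x * cosh u) * cosh (\<alpha> * u))"
      by (auto simp: indicator_def)
  qed
  finally show ?thesis by (simp add: macdonald_def)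
qed

text \<open>Beyond \<open>u = 1\<close> the integrand of either function contributes at most a multiple of
  \<open>exp (- x * cosh 1)\<close>, which the part below \<open>u = 1\<close> already dominates.\<close>

lemma macdonald_comparable:
  obtains C where "C > 0" "\<And>x. x \<ge> 1 \<Longrightarrow> macdonald \<beta> x \<le> C * macdonald \<gamma> x"
proof
  \<comment> \<open>The summand \<open>cosh \<beta>\<close> comes from u in [0,1]. The other one
    comes from u > 1, where the tail is at most
    \<open>exp (- (x - 1) * cosh 1) * macdonald \<beta> 1\<close>.\<close>
  define C where "C = cosh \<beta> + exp (cosh 1) * macdonald \<beta> 1"
  show "C > 0" unfolding C_def using macdonald_nonneg[of \<beta> 1] by (simp add: add_pos_nonneg)
  fix x :: real assume x: "x \<ge> 1"
  have "macdonald \<beta> x \<le> (LINT u:{0..}|lborel. cosh \<beta> * (exp (- x * cosh u) * cosh (\<gamma> * u)) +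
      exp (- (x - 1) * cosh 1) * (exp (- 1 * cosh u) * cosh (\<beta> * u)))"
    unfolding macdonald_def
  proof (rule set_integral_mono)
    show "set_integrable lborel {0..} (\<lambda>u. exp (- x * cosh u) * cosh (\<beta> * u))"
      using x by (intro set_integrable_macdonald) auto
    show "set_integrable lborel {0..} (\<lambda>u. cosh \<beta> * (exp (- x * cosh u) * cosh (\<gamma> * u)) +
      exp (- (x - 1) * cosh 1) * (exp (- 1 * cosh u) * cosh (\<beta> * u)))"
      using x by (intro set_integral_add set_integrable_mult_right set_integrable_macdonald) auto
    fix u :: real assume "u \<in> {0..}"
    then have u: "u \<ge> 0" by simp
    show "exp (- x * cosh u) * cosh (\<beta> * u) \<le> cosh \<beta> * (exp (- x * cosh u) * cosh (\<gamma> * u)) +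
      exp (- (x - 1) * cosh 1) * (exp (- 1 * cosh u) * cosh (\<beta> * u))"
    proof (cases "u \<le> 1")
      case True
      have "\<bar>\<beta> * u\<bar> \<le> \<bar>\<beta>\<bar>" using True u by (simp add: abs_mult mult_left_le)
      then have "cosh (\<beta> * u) \<le> cosh \<beta>"
        by (metis abs_ge_zero cosh_real_abs cosh_real_nonneg_le_iff)
      also have "\<dots> \<le> cosh \<beta> * cosh (\<gamma> * u)"
        by (simp add: cosh_real_ge_1)
      finally have "exp (- x * cosh u) * cosh (\<beta> * u) \<le> exp (- x * cosh u) * (cosh \<beta> * cosh (\<gamma> * u))"
        by (rule mult_left_mono) simp
      then show ?thesis by (simp add: mult_ac add_increasing2)
    next
      case False
      \<comment> \<open>One unit of \<open>x\<close> is kept back to ensure convergence in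
        \<open>u\<close>; the remaining factor, with \<open>x - 1 \<ge> 0\<close>, is largest at u =
        1.\<close>
      have "exp (- x * cosh u) = exp (- (x - 1) * cosh u) * exp (- 1 * cosh u)"
        by (simp add: algebra_simps flip: exp_add)
      also have "\<dots> \<le> exp (- (x - 1) * cosh 1) * exp (- 1 * cosh u)"
      proof -
        have "(x - 1) * cosh 1 \<le> (x - 1) * cosh u"
          using x False by (intro mult_left_mono) (auto simp: cosh_real_nonneg_le_iff)
        then have "- (x - 1) * cosh u \<le> - (x - 1) * cosh 1" by linarith
        then show ?thesis by (simp only: exp_le_cancel_iff mult_le_cancel_right_pos exp_gt_zero)
      qed
      finally have "exp (- x * cosh u) * cosh (\<beta> * u) \<le> exp (- (x - 1) * cosh 1) * (exp (- 1 * cosh u) * cosh (\<beta> * u))"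
        by (simp add: mult_right_mono flip: mult.assoc)
      then show ?thesis by (simp add: add_increasing)
    qed
  qed
  also have "\<dots> = cosh \<beta> * macdonald \<gamma> x + exp (- (x - 1) * cosh 1) * macdonald \<beta> 1"
  proof -
    have "set_integrable lborel {0..} (\<lambda>u. exp (- x * cosh u) * cosh (\<gamma> * u))"
      "set_integrable lborel {0..} (\<lambda>u. exp (- 1 * cosh u) * cosh (\<beta> * u))"
      using x by (rule_tac set_integrable_macdonald, linarith)+
    then show ?thesis
      unfolding macdonald_def by (simp only: set_integral_add(2) set_integrable_mult_right set_integral_mult_right)
  qed
  also have "exp (- (x - 1) * cosh 1) = exp (cosh 1) * exp (- x * cosh 1)"
    by (simp add: algebra_simps flip: exp_add)
  also have "cosh \<beta> * macdonald \<gamma> x + exp (cosh 1) * exp (- x * cosh 1) * macdonald \<beta> 1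
    \<le> cosh \<beta> * macdonald \<gamma> x + exp (cosh 1) * macdonald \<gamma> x * macdonald \<beta> 1"
    using x by (intro add_left_mono mult_right_mono mult_left_mono macdonald_ge macdonald_nonneg) auto
  also have "\<dots> = C * macdonald \<gamma> x" by (simp add: C_def algebra_simps)
  finally show "macdonald \<beta> x \<le> C * macdonald \<gamma> x" .
qed

text \<open>Integrate the derivative of \<open>sinh (\<alpha> * u) * cosh u powr (- p)\<close>,
  which vanishes at 0 and at infinity. The addition formula for
  \<open>cosh ((\<alpha> + 1) * u)\<close> writes that derivative as a combination of the two
  integrands.\<close>

lemma cosh_integral_Suc:
  assumes p: "p > \<bar>\<alpha>\<bar>"
  shows "p * cosh_integral (\<alpha> + 1) (p + 1) = (p + \<alpha>) * cosh_integral \<alpha> p"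
proof -
  define F where "F u = sinh (\<alpha> * u) * cosh u powr (- p)" for u
  define F' where "F' u = (p + \<alpha>) * (cosh (\<alpha> * u) * cosh u powr (- p))
      - p * (cosh ((\<alpha> + 1) * u) * cosh u powr (- (p + 1)))" for u
  have int1: "set_integrable lborel {0..} (\<lambda>u. cosh (\<alpha> * u) * cosh u powr (- p))"
    and int2: "set_integrable lborel {0..} (\<lambda>u. cosh ((\<alpha> + 1) * u) * cosh u powr (- (p + 1)))"
    using p by (rule set_integrable_cosh_integral, intro set_integrable_cosh_integral) linarith
  have F'_int: "set_integrable lborel {0..} F'"
    unfolding F'_def using int1 int2 by (intro set_integral_diff set_integrable_mult_right)
  have deriv: "(F has_real_derivative F' u) (at u)" for u
  proof -
    have "(F has_real_derivative (\<alpha> * cosh (\<alpha> * u)) * cosh u powr (- p)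
        + sinh (\<alpha> * u) * ((- p) * cosh u powr (- p - 1) * sinh u)) (at u)"
      unfolding F_def by (auto intro!: derivative_eq_intros)
    also have "(\<alpha> * cosh (\<alpha> * u)) * cosh u powr (- p)
        + sinh (\<alpha> * u) * ((- p) * cosh u powr (- p - 1) * sinh u) = F' u"
    proof -
      have eq: "cosh u powr (- p) = cosh u * cosh u powr (- p - 1)"
        by (simp add: powr_diff)
      have "(\<alpha> + 1) * u = \<alpha> * u + u" by (simp add: algebra_simps)
      then have eq2: "cosh ((\<alpha> + 1) * u) = cosh (\<alpha> * u) * cosh u + sinh (\<alpha> * u) * sinh u"
        by (simp only: cosh_add)
      have "- (p + 1) = - p - 1" by simp
      then show ?thesis unfolding F'_def eq2 eq by (simp only:) (simp add: algebra_simps)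
    qed
    finally show ?thesis .
  qed
  have FTC: "(LINT u:{0..b}|lborel. F' u) = F b - F 0" if "b \<ge> 0" for b
  proof -
    have "set_integrable lborel {0..b} F'"
      by (rule set_integrable_subset[OF F'_int]) auto
    then have "(LINT u:{0..b}|lborel. F' u) = integral {0..b} F'"
      by (rule set_borel_integral_eq_integral(2))
    also have "\<dots> = F b - F 0"
      by (rule integral_unique, rule fundamental_theorem_of_calculus[OF that])
         (auto intro: has_field_derivative_at_within deriv simp flip: has_real_derivative_iff_has_vector_derivative)
    finally show ?thesis .
  qed
  have lim: "((\<lambda>b. LINT u:{0..b}|lborel. F' u) \<longlongrightarrow> (LINT u:{0..}|lborel. F' u)) at_top"
    using F'_int by (intro tendsto_set_lebesgue_integral_at_top) auto
  have "(F \<longlongrightarrow> 0) at_top"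
  proof (rule Lim_null_comparison)
    show "eventually (\<lambda>u. norm (F u) \<le> 2 powr p * exp (- (p - \<bar>\<alpha>\<bar>) * u)) at_top"
      using eventually_ge_at_top[of 0]
    proof eventually_elim
      case (elim u)
      have "\<bar>sinh (\<alpha> * u)\<bar> \<le> cosh (\<alpha> * u)"
        by (metis sinh_le_cosh_real sinh_real_abs cosh_real_abs)
      then have "norm (F u) \<le> cosh (\<alpha> * u) * cosh u powr (- p)"
        by (simp add: F_def abs_mult mult_right_mono)
      also have "\<dots> \<le> 2 powr p * exp (- (p - \<bar>\<alpha>\<bar>) * u)"
        using p elim by (intro cosh_product_le) auto
      finally show ?case .
    qed
    show "((\<lambda>u. 2 powr p * exp (- (p - \<bar>\<alpha>\<bar>) * u)) \<longlongrightarrow> 0) at_top"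
      using p by real_asymp
  qed
  moreover have "F 0 = 0" by (simp add: F_def)
  ultimately have "((\<lambda>b. LINT u:{0..b}|lborel. F' u) \<longlongrightarrow> 0) at_top"
    by (rule_tac Lim_transform_eventually[of F])
       (auto intro!: eventually_mono[OF eventually_ge_at_top[of 0]] simp: FTC)
  then have "(LINT u:{0..}|lborel. F' u) = 0"
    using lim by (intro tendsto_unique) auto
  moreover have "(LINT u:{0..}|lborel. F' u) = (p + \<alpha>) * cosh_integral \<alpha> p - p * cosh_integral (\<alpha> + 1) (p + 1)"
    unfolding F'_def cosh_integral_def using int1 int2 by (subst set_integral_diff(2)) auto
  ultimately show ?thesis by simp
qed

lemma cosh_integral_nonneg: "cosh_integral \<alpha> s \<ge> 0"
  unfolding cosh_integral_def set_lebesgue_integral_def by (intro Bochner_Integration.integral_nonneg) auto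

lemma ennreal_cosh_integral:
  assumes "s > \<bar>\<alpha>\<bar>"
  shows "ennreal (cosh_integral \<alpha> s) =
    (\<integral>\<^sup>+u. indicator {0..} u * ennreal (cosh (\<alpha> * u) * cosh u powr (- s)) \<partial>lborel)"
  using nn_integral_eq_integral[OF set_integrable_cosh_integral[OF assms, unfolded set_integrable_def]]
  by (simp add: cosh_integral_def set_lebesgue_integral_def ennreal_mult'' ennreal_indicator)

text \<open>Euler's integral for \<open>Gamma p\<close> after the substitution of
  \<open>c * x\<close> for the variable.\<close>

lemma nn_integral_powr_exp:
  fixes c p :: real
  assumes "c > 0" "p > 0"
  shows "(\<integral>\<^sup>+x. indicator {0..} x * ennreal (x powr (p - 1) * exp (- c * x)) \<partial>lborel) =
    ennreal (Gamma p * c powr (- p))"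
proof -
  have "ennreal (Gamma p) = (\<integral>\<^sup>+t. ennreal (indicator {0..} t * t powr (p - 1) / exp t) \<partial>lborel)"
    using assms by (simp add: Gamma_conv_nn_integral_real)
  also have "\<dots> = ennreal c * (\<integral>\<^sup>+x. ennreal (indicator {0..} (c * x) * (c * x) powr (p - 1) / exp (c * x)) \<partial>lborel)"
    by (subst nn_integral_real_affine[where c = c and t = 0]) (use assms in auto)
  also have "\<dots> = ennreal c * (\<integral>\<^sup>+x. ennreal (c powr (p - 1)) * (indicator {0..} x * ennreal (x powr (p - 1) * exp (- c * x))) \<partial>lborel)"
    using assms by (intro arg_cong2[where f = "(*)"] refl nn_integral_cong)
      (auto simp: indicator_def zero_le_mult_iff powr_mult exp_minus divide_inverse mult.assoc simp flip: ennreal_mult)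
  also have "\<dots> = ennreal (c powr p) * (\<integral>\<^sup>+x. indicator {0..} x * ennreal (x powr (p - 1) * exp (- c * x)) \<partial>lborel)"
  proof -
    have "ennreal c * (ennreal (c powr (p - 1)) * I) = ennreal (c powr p) * I" for I
      using assms by (simp add: powr_mult_base flip: mult.assoc ennreal_mult)
    then show ?thesis by (subst nn_integral_cmult) auto
  qed
  finally have *: "ennreal (Gamma p) = \<dots>" .
  have "ennreal (c powr (- p)) * ennreal (Gamma p) =
     (ennreal (c powr (- p)) * ennreal (c powr p)) * (\<integral>\<^sup>+x. indicator {0..} x * ennreal (x powr (p - 1) * exp (- c * x)) \<partial>lborel)"
    unfolding * by (simp add: mult.assoc)
  also have "ennreal (c powr (- p)) * ennreal (c powr p) = 1"
    using assms by (simp flip: ennreal_mult powr_add)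
  finally show ?thesis using Gamma_real_nonneg[of p] assms
    by (simp add: ennreal_mult mult.commute)
qed

text \<open>In the variable x = |z|^2 this is a Mellin transform. Exchanging the integrals leaves a
  Gamma integral in x with rate \<open>t * cosh u\<close>, whose value contributes the power of
  \<open>cosh u\<close>. The scale t is 1 for the moments and 1/2 for exponential
  integrability.\<close>

lemma macdonald_moment:
  assumes t: "t > 0" and p: "p > \<bar>\<alpha>\<bar>"
  shows "(\<integral>\<^sup>+z. ennreal (macdonald \<alpha> (t * (cmod z)\<^sup>2) * cmod z powr (2 * p - 2)) \<partial>lborel) =
    ennreal (pi * Gamma p * t powr (- p) * cosh_integral \<alpha> p)"
proof -
  have p0: "p > 0" using p by linarith
  have "(\<integral>\<^sup>+z. ennreal (macdonald \<alpha> (t * (cmod z)\<^sup>2) * cmod z powr (2 * p - 2)) \<partial>lborel) =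
      (\<integral>\<^sup>+z. ennreal (macdonald \<alpha> (t * (cmod z)\<^sup>2) * ((cmod z)\<^sup>2) powr (p - 1)) \<partial>lborel)"
  proof (rule nn_integral_cong)
    fix z :: complex
    have "((cmod z)\<^sup>2) powr (p - 1) = cmod z powr (2 * p - 2)"
      by (cases "z = 0") (simp_all add: powr_powr right_diff_distrib flip: powr_numeral)
    then show "ennreal (macdonald \<alpha> (t * (cmod z)\<^sup>2) * cmod z powr (2 * p - 2)) =
      ennreal (macdonald \<alpha> (t * (cmod z)\<^sup>2) * ((cmod z)\<^sup>2) powr (p - 1))" by simp
  qed
  also have "\<dots> = ennreal pi * (\<integral>\<^sup>+x. indicator {0..} x * ennreal (macdonald \<alpha> (t * x) * x powr (p - 1)) \<partial>lborel)"
    by (rule nn_integral_complex_radial) measurable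
  also have "(\<integral>\<^sup>+x. indicator {0..} x * ennreal (macdonald \<alpha> (t * x) * x powr (p - 1)) \<partial>lborel) =
      (\<integral>\<^sup>+x. (\<integral>\<^sup>+u. (indicator {0..} u * ennreal (cosh (\<alpha> * u))) *
         (indicator {0..} x * ennreal (x powr (p - 1) * exp (- (t * cosh u) * x))) \<partial>lborel) \<partial>lborel)"
  proof (rule nn_integral_cong)
    fix x :: real
    show "indicator {0..} x * ennreal (macdonald \<alpha> (t * x) * x powr (p - 1)) = 
      (\<integral>\<^sup>+u. (indicator {0..} u * ennreal (cosh (\<alpha> * u))) *
         (indicator {0..} x * ennreal (x powr (p - 1) * exp (- (t * cosh u) * x))) \<partial>lborel)"
    proof (cases "x > 0")
      case True
      have "ennreal (macdonald \<alpha> (t * x) * x powr (p - 1)) = 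
         (\<integral>\<^sup>+u. (indicator {0..} u * ennreal (exp (- (t * x) * cosh u) * cosh (\<alpha> * u))) * ennreal (x powr (p - 1)) \<partial>lborel)"
        using True t by (subst nn_integral_multc) (auto simp: ennreal_macdonald ennreal_mult'')
      also have "\<dots> = (\<integral>\<^sup>+u. (indicator {0..} u * ennreal (cosh (\<alpha> * u))) *
         (ennreal (x powr (p - 1) * exp (- (t * cosh u) * x))) \<partial>lborel)"
        by (rule nn_integral_cong) (auto simp: ennreal_mult mult_ac)
      finally show ?thesis using True by simp
    next
      case False
      \<comment> \<open>At x = 0 the value of \<open>macdonald\<close> is immaterial, since
        \<open>0 powr (p - 1) = 0\<close> makes both sides vanish.\<close>
      then have "x < 0 \<or> x = 0" by auto
      then show ?thesis by auto
    qed
  qed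
  also have "\<dots> = (\<integral>\<^sup>+u. (\<integral>\<^sup>+x. (indicator {0..} u * ennreal (cosh (\<alpha> * u))) *
         (indicator {0..} x * ennreal (x powr (p - 1) * exp (- (t * cosh u) * x))) \<partial>lborel) \<partial>lborel)"
    by (rule lborel_pair.Fubini') measurable
  also have "\<dots> = (\<integral>\<^sup>+u. ennreal (Gamma p * t powr (- p)) * (indicator {0..} u * ennreal (cosh (\<alpha> * u) * cosh u powr (- p))) \<partial>lborel)"
  proof (rule nn_integral_cong)
    fix u :: real
    have "(\<integral>\<^sup>+x. (indicator {0..} u * ennreal (cosh (\<alpha> * u))) *
         (indicator {0..} x * ennreal (x powr (p - 1) * exp (- (t * cosh u) * x))) \<partial>lborel) =
       (indicator {0..} u * ennreal (cosh (\<alpha> * u))) * ennreal (Gamma p * (t * cosh u) powr (- p))"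
      using t p0 by (subst nn_integral_cmult) (auto simp: nn_integral_powr_exp[of "t * cosh u" p, simplified])
    also have "\<dots> = ennreal (Gamma p * t powr (- p)) * (indicator {0..} u * ennreal (cosh (\<alpha> * u) * cosh u powr (- p)))"
      using t p0 by (simp add: powr_mult ennreal_mult Gamma_real_nonneg mult_ac)
    finally show "(\<integral>\<^sup>+x. (indicator {0..} u * ennreal (cosh (\<alpha> * u))) *
         (indicator {0..} x * ennreal (x powr (p - 1) * exp (- (t * cosh u) * x))) \<partial>lborel) = \<dots>" .
  qed
  also have "\<dots> = ennreal (Gamma p * t powr (- p)) * ennreal (cosh_integral \<alpha> p)"
    using p by (simp add: nn_integral_cmult ennreal_cosh_integral)
  finally show ?thesis
    using p0 by (simp add: ennreal_mult cosh_integral_nonneg Gamma_real_nonneg mult_ac)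
qed

section \<open>The weighted measures\<close>

text \<open>Leaving the order \<alpha> free treats both parities at once and allows the two weights
  to be compared.\<close>

definition nu_density :: "real \<Rightarrow> real \<Rightarrow> complex \<Rightarrow> real" where
  "nu_density \<mu> \<alpha> z = 2 powr (1/2 - \<mu>) / (pi * Gamma (\<mu> + 1/2))
     * macdonald \<alpha> ((cmod z)\<^sup>2) * cmod z powr (2 * \<mu> + 1)"

text \<open>The integral of |z|^(2n) against \<open>nu_density\<close>, by
  \<open>macdonald_moment\<close>. With x = |z|^2 the powers of |z| combine to x^(p - 1) for p = n +
  \<mu> + 3/2.\<close>

definition nu_moment :: "real \<Rightarrow> real \<Rightarrow> nat \<Rightarrow> real" where
  "nu_moment \<mu> \<alpha> n = 2 powr (1/2 - \<mu>) / (pi * Gamma (\<mu> + 1/2))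
     * (pi * Gamma (n + \<mu> + 3/2) * cosh_integral \<alpha> (n + \<mu> + 3/2))"

lemma nu_even_density_eq: "nu_even_density \<mu> = nu_density \<mu> (\<mu> - 1/2)"
  and nu_odd_density_eq: "nu_odd_density \<mu> = nu_density \<mu> (\<mu> + 1/2)"
  by (simp_all add: fun_eq_iff nu_even_density_def nu_odd_density_def nu_density_def)

lemma borel_measurable_nu_density [measurable]: "nu_density \<mu> \<alpha> \<in> borel_measurable borel"
  unfolding nu_density_def by measurable

text \<open>Since \<open>cosh u \<ge> 1\<close>, half of the exponent \<open>x * cosh u\<close>
  absorbs \<open>x / 2\<close>, and the other half still gives a Macdonald integrand.\<close>

lemma exp_macdonald_le:
  assumes "x > 0"
  shows "exp (x / 2) * macdonald \<alpha> x \<le> macdonald \<alpha> (x / 2)"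
proof -
  have "exp (x / 2) * macdonald \<alpha> x = (LINT u:{0..}|lborel. exp (x / 2) * (exp (- x * cosh u) * cosh (\<alpha> * u)))"
    by (simp add: macdonald_def)
  also have "\<dots> \<le> (LINT u:{0..}|lborel. exp (- (x / 2) * cosh u) * cosh (\<alpha> * u))"
  proof (rule set_integral_mono)
    show "set_integrable lborel {0..} (\<lambda>u. exp (x / 2) * (exp (- x * cosh u) * cosh (\<alpha> * u)))"
      using assms by (intro set_integrable_mult_right set_integrable_macdonald)
    show "set_integrable lborel {0..} (\<lambda>u. exp (- (x / 2) * cosh u) * cosh (\<alpha> * u))"
      using assms by (intro set_integrable_macdonald) auto
    fix u :: real
    have "x / 2 * 1 \<le> x / 2 * cosh u" using assms by (intro mult_left_mono cosh_real_ge_1) auto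
    then have "exp (x / 2) * exp (- x * cosh u) \<le> exp (- (x / 2) * cosh u)"
      by (simp flip: exp_add)
    from mult_right_mono[OF this, of "cosh (\<alpha> * u)"]
    show "exp (x / 2) * (exp (- x * cosh u) * cosh (\<alpha> * u)) \<le> exp (- (x / 2) * cosh u) * cosh (\<alpha> * u)"
      by (simp add: mult.assoc)
  qed
  finally show ?thesis by (simp add: macdonald_def)
qed

context
  fixes \<mu> :: real
  assumes \<mu>: "\<mu> > - 1/2"
begin

lemma nu_const_pos: "2 powr (1/2 - \<mu>) / (pi * Gamma (\<mu> + 1/2)) > 0"
  using \<mu> by (intro divide_pos_pos mult_pos_pos Gamma_real_pos) auto

lemma nu_density_nonneg: "nu_density \<mu> \<alpha> z \<ge> 0"
  unfolding nu_density_def using nu_const_pos macdonald_nonneg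
  by (intro mult_nonneg_nonneg) (auto simp: less_imp_le)

lemma nu_moment_nonneg: "nu_moment \<mu> \<alpha> n \<ge> 0"
  unfolding nu_moment_def using nu_const_pos \<mu>
  by (intro mult_nonneg_nonneg cosh_integral_nonneg Gamma_real_nonneg) (auto simp: less_imp_le)

text \<open>The bound on |\<alpha>| is the condition \<open>p > \<bar>\<alpha>\<bar>\<close> of
  \<open>macdonald_moment\<close> at n = 0, and so it suffices for every n.\<close>

lemma nn_integral_nu_density_power:
  assumes \<alpha>: "\<bar>\<alpha>\<bar> < \<mu> + 3/2"
  shows "(\<integral>\<^sup>+z. ennreal (nu_density \<mu> \<alpha> z) * ennreal (cmod z ^ (2 * n)) \<partial>lborel) = ennreal (nu_moment \<mu> \<alpha> n)"
proof -
  define c where "c = 2 powr (1/2 - \<mu>) / (pi * Gamma (\<mu> + 1/2))"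
  define p where "p = n + \<mu> + 3/2"
  have c: "c > 0" unfolding c_def by (rule nu_const_pos)
  have "ennreal (nu_density \<mu> \<alpha> z) * ennreal (cmod z ^ (2 * n)) =
      ennreal c * ennreal (macdonald \<alpha> (1 * (cmod z)\<^sup>2) * cmod z powr (2 * p - 2))" for z
  proof -
    have "cmod z powr (2 * \<mu> + 1) * cmod z ^ (2 * n) = cmod z powr (2 * p - 2)"
    proof (cases "z = 0")
      case False
      have "cmod z powr (2 * \<mu> + 1) * cmod z powr (real (2 * n)) = cmod z powr (2 * p - 2)"
        unfolding powr_add[symmetric] p_def by (simp add: algebra_simps)
      then show ?thesis using False powr_realpow[of "cmod z" "2 * n"] by simp
    qed auto
    then have "nu_density \<mu> \<alpha> z * cmod z ^ (2 * n) = c * (macdonald \<alpha> (1 * (cmod z)\<^sup>2) * cmod z powr (2 * p - 2))"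
      by (simp add: nu_density_def c_def[symmetric] mult.assoc)
    then show ?thesis using c nu_density_nonneg[of \<alpha> z]
      by (simp flip: ennreal_mult ennreal_mult')
  qed
  then have "(\<integral>\<^sup>+z. ennreal (nu_density \<mu> \<alpha> z) * ennreal (cmod z ^ (2 * n)) \<partial>lborel) =
      ennreal c * (\<integral>\<^sup>+z. ennreal (macdonald \<alpha> (1 * (cmod z)\<^sup>2) * cmod z powr (2 * p - 2)) \<partial>lborel)"
    by (simp add: nn_integral_cmult)
  also have "\<dots> = ennreal c * ennreal (pi * Gamma p * 1 powr (- p) * cosh_integral \<alpha> p)"
    using \<alpha> by (subst macdonald_moment) (auto simp: p_def)
  also have "\<dots> = ennreal (nu_moment \<mu> \<alpha> n)"
    unfolding nu_moment_def c_def[symmetric] p_def[symmetric] using c by (simp add: ennreal_mult')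
  finally show ?thesis .
qed

text \<open>The recurrence \<open>cosh_integral_Suc\<close> at order \<mu> - 1/2, where p + \<alpha>
  = n + 1 + 2\<mu>; the factor p is absorbed into \<open>Gamma (p + 1)\<close>.\<close>

lemma nu_moment_odd_Suc:
  "nu_moment \<mu> (\<mu> + 1/2) (Suc n) = (n + 1 + 2 * \<mu>) * nu_moment \<mu> (\<mu> - 1/2) n"
proof -
  define p where "p = n + \<mu> + 3/2"
  have p: "p > \<bar>\<mu> - 1/2\<bar>" "p > 0" using \<mu> by (auto simp: p_def abs_if)
  have "p * cosh_integral (\<mu> + 1/2) (p + 1) = (n + 1 + 2 * \<mu>) * cosh_integral (\<mu> - 1/2) p"
    using cosh_integral_Suc[OF p(1)] by (simp add: p_def algebra_simps)
  moreover have "Gamma (p + 1) = p * Gamma p" using p by (intro Gamma_plus1) (auto elim!: nonpos_Ints_cases)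
  ultimately have "Gamma (p + 1) * cosh_integral (\<mu> + 1/2) (p + 1) =
      (n + 1 + 2 * \<mu>) * (Gamma p * cosh_integral (\<mu> - 1/2) p)"
    by (metis mult.assoc mult.left_commute)
  moreover have "real (Suc n) + \<mu> + 3/2 = p + 1" by (simp add: p_def)
  ultimately show ?thesis by (simp add: nu_moment_def p_def[symmetric] mult.assoc del: of_nat_Suc)
qed

text \<open>\<open>cosh_integral\<close> is even in its order, so the recurrence can also lower the
  order: at -(\<mu> + 1/2) it leads to -(\<mu> - 1/2), and there p + \<alpha> = n + 1.\<close>

lemma nu_moment_even_Suc:
  "nu_moment \<mu> (\<mu> - 1/2) (Suc n) = (n + 1) * nu_moment \<mu> (\<mu> + 1/2) n"
proof -
  define p where "p = n + \<mu> + 3/2"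
  have p: "p > \<bar>- (\<mu> + 1/2)\<bar>" "p > 0" using \<mu> by (auto simp: p_def abs_if)
  have minus: "cosh_integral (- \<alpha>) s = cosh_integral \<alpha> s" for \<alpha> s
    by (simp add: cosh_integral_def)
  have "- (\<mu> + 1/2) + 1 = - (\<mu> - 1/2)" by simp
  then have "p * cosh_integral (\<mu> - 1/2) (p + 1) = (n + 1) * cosh_integral (\<mu> + 1/2) p"
    using cosh_integral_Suc[OF p(1)] by (simp only: minus) (simp add: p_def algebra_simps)
  moreover have "Gamma (p + 1) = p * Gamma p" using p by (intro Gamma_plus1) (auto elim!: nonpos_Ints_cases)
  ultimately have "Gamma (p + 1) * cosh_integral (\<mu> - 1/2) (p + 1) =
      (n + 1) * (Gamma p * cosh_integral (\<mu> + 1/2) p)"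
    by (metis mult.assoc mult.left_commute)
  moreover have "real (Suc n) + \<mu> + 3/2 = p + 1" by (simp add: p_def)
  ultimately show ?thesis by (simp add: nu_moment_def p_def[symmetric] mult.assoc del: of_nat_Suc)
qed

text \<open>\<open>exp_macdonald_le\<close> reduces the integral to a moment at scale t = 1/2. The
  result controls the exponential term of Young's inequality.\<close>

lemma nn_integral_nu_density_exp_finite:
  assumes \<alpha>: "\<bar>\<alpha>\<bar> < \<mu> + 3/2"
  shows "(\<integral>\<^sup>+z. ennreal (nu_density \<mu> \<alpha> z) * ennreal (exp ((cmod z)\<^sup>2 / 2)) \<partial>lborel) < \<infinity>"
proof -
  define c where "c = 2 powr (1/2 - \<mu>) / (pi * Gamma (\<mu> + 1/2))"
  define p where "p = \<mu> + 3/2"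
  have c: "c > 0" unfolding c_def by (rule nu_const_pos)
  have "ennreal (nu_density \<mu> \<alpha> z) * ennreal (exp ((cmod z)\<^sup>2 / 2)) \<le>
      ennreal c * ennreal (macdonald \<alpha> (1/2 * (cmod z)\<^sup>2) * cmod z powr (2 * p - 2))" for z
  proof -
    have "nu_density \<mu> \<alpha> z * exp ((cmod z)\<^sup>2 / 2) \<le> c * (macdonald \<alpha> (1/2 * (cmod z)\<^sup>2) * cmod z powr (2 * p - 2))"
    proof (cases "z = 0")
      case False
      then have "exp ((cmod z)\<^sup>2 / 2) * macdonald \<alpha> ((cmod z)\<^sup>2) \<le> macdonald \<alpha> ((cmod z)\<^sup>2 / 2)"
        by (intro exp_macdonald_le) auto
      then have "c * (exp ((cmod z)\<^sup>2 / 2) * macdonald \<alpha> ((cmod z)\<^sup>2) * cmod z powr (2 * \<mu> + 1))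
        \<le> c * (macdonald \<alpha> ((cmod z)\<^sup>2 / 2) * cmod z powr (2 * \<mu> + 1))"
        using c by (intro mult_left_mono mult_right_mono) auto
      moreover have e: "2 * p - 2 = 2 * \<mu> + 1" by (simp add: p_def)
      ultimately show ?thesis unfolding e nu_density_def c_def[symmetric] by (simp add: mult_ac)
    qed (simp add: nu_density_def)
    then show ?thesis using c nu_density_nonneg[of \<alpha> z]
      by (simp add: ennreal_leI flip: ennreal_mult ennreal_mult')
  qed
  then have "(\<integral>\<^sup>+z. ennreal (nu_density \<mu> \<alpha> z) * ennreal (exp ((cmod z)\<^sup>2 / 2)) \<partial>lborel) \<le>
      (\<integral>\<^sup>+z. ennreal c * ennreal (macdonald \<alpha> (1/2 * (cmod z)\<^sup>2) * cmod z powr (2 * p - 2)) \<partial>lborel)"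
    by (rule nn_integral_mono)
  also have "\<dots> = ennreal c * ennreal (pi * Gamma p * (1/2) powr (- p) * cosh_integral \<alpha> p)"
    using \<alpha> by (subst nn_integral_cmult, measurable, subst macdonald_moment) (auto simp: p_def)
  also have "\<dots> < \<infinity>" by (simp add: ennreal_mult_less_top)
  finally show ?thesis .
qed

lemma nn_integral_nu_density_finite:
  assumes \<alpha>: "\<bar>\<alpha>\<bar> < \<mu> + 3/2"
  shows "(\<integral>\<^sup>+z. ennreal (nu_density \<mu> \<alpha> z) \<partial>lborel) < \<infinity>"
  using nn_integral_nu_density_power[OF \<alpha>, of 0] by simp

lemma nn_integral_nu_density_power_series:
  assumes \<alpha>: "\<bar>\<alpha>\<bar> < \<mu> + 3/2" and f: "\<And>z. (\<lambda>n. a n * z ^ n) sums f z"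
  shows "(\<integral>\<^sup>+z. ennreal (nu_density \<mu> \<alpha> z) * ennreal ((cmod (f z))\<^sup>2) \<partial>lborel) =
    (\<Sum>n. ennreal ((cmod (a n))\<^sup>2 * nu_moment \<mu> \<alpha> n))"
proof -
  \<comment> \<open>Evaluating the radial density at the real point \<open>cmod z\<close> exhibits
    it as a function of the radius, the form that \<open>nn_integral_radial_power_series\<close>
    expects.\<close>
  have "(\<integral>\<^sup>+z. ennreal (nu_density \<mu> \<alpha> (of_real (cmod z))) * ennreal ((cmod (f z))\<^sup>2) \<partial>lborel) =
    (\<Sum>n. ennreal ((cmod (a n))\<^sup>2) * (\<integral>\<^sup>+z. ennreal (nu_density \<mu> \<alpha> (of_real (cmod z))) * ennreal (cmod z ^ (2 * n)) \<partial>lborel))"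
    by (rule nn_integral_radial_power_series[where \<phi> = "\<lambda>r. ennreal (nu_density \<mu> \<alpha> (of_real r))"]) (use f in auto)
  moreover have "nu_density \<mu> \<alpha> (of_real (cmod z)) = nu_density \<mu> \<alpha> z" for z
    by (simp add: nu_density_def)
  ultimately show ?thesis
    by (simp add: nn_integral_nu_density_power[OF \<alpha>] nu_moment_nonneg ennreal_mult)
qed

end

section \<open>Entropy and the weighted norm\<close>

lemma entire_sums:
  assumes "f holomorphic_on UNIV"
  shows "(\<lambda>n. (deriv ^^ n) f z / fact n * w ^ n) sums f (z + w)"
  using holomorphic_power_series[of f z "norm w + 1" "z + w"] holomorphic_on_subset[OF assms]
  by (auto simp: dist_norm)

lemma borel_measurable_entire:
  "f holomorphic_on UNIV \<Longrightarrow> f \<in> borel_measurable borel"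
  by (intro borel_measurable_continuous_onI holomorphic_on_imp_continuous_on)

text \<open>Expand f about z. By \<open>nn_integral_radial_power_series\<close> the integral over
  the disc is a sum of nonnegative terms, and the term of index 0 is the left-hand side.\<close>

lemma entire_sub_mean_value:
  assumes f: "f holomorphic_on UNIV"
  shows "ennreal (pi * (cmod (f z))\<^sup>2) \<le> (\<integral>\<^sup>+w. indicator (ball z 1) w * ennreal ((cmod (f w))\<^sup>2) \<partial>lborel)"
proof -
  have [measurable]: "f \<in> borel_measurable borel" using f by (rule borel_measurable_entire)
  have [measurable]: "ball z 1 \<in> sets borel" by simp
  let ?a = "\<lambda>n. (deriv ^^ n) f z / fact n"
  let ?\<phi> = "indicator {..<1::real} :: real \<Rightarrow> ennreal"
  let ?t = "\<lambda>n. ennreal ((cmod (?a n))\<^sup>2) * (\<integral>\<^sup>+w. ?\<phi> (cmod w) * ennreal (cmod w ^ (2 * n)) \<partial>lborel)"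
  have "(\<integral>\<^sup>+w. ?\<phi> (cmod w) \<partial>lborel) = (\<integral>\<^sup>+w. indicator (ball 0 1 :: complex set) w \<partial>lborel)"
    by (intro nn_integral_cong) (auto simp: indicator_def)
  then have "(\<integral>\<^sup>+w. ?\<phi> (cmod w) \<partial>lborel) = ennreal pi"
    by (simp add: emeasure_ball unit_ball_vol_2)
  then have "ennreal (pi * (cmod (f z))\<^sup>2) = ?t 0"
    by (simp add: ennreal_mult mult.commute)
  also have "\<dots> \<le> suminf ?t"
    using sum_le_suminf[of ?t "{0}"] by (simp del: funpow_0 fact_0)
  also have "\<dots> = (\<integral>\<^sup>+w. ?\<phi> (cmod w) * ennreal ((cmod (f (z + w)))\<^sup>2) \<partial>lborel)"
    using entire_sums[OF f] by (intro nn_integral_radial_power_series[symmetric]) auto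
  also have "\<dots> = (\<integral>\<^sup>+w. indicator (ball z 1) (z + w) * ennreal ((cmod (f (z + w)))\<^sup>2) \<partial>lborel)"
    by (intro nn_integral_cong) (auto simp: indicator_def dist_norm)
  also have "\<dots> = (\<integral>\<^sup>+w. indicator (ball z 1) w * ennreal ((cmod (f w))\<^sup>2) \<partial>lborel)"
    by (rule nn_integral_lborel_shift) measurable
  finally show ?thesis .
qed

lemma entropy_integrand_ge: "s * ln s \<ge> - 1" if "s \<ge> 0" for s :: real
proof (cases "s = 0")
  case False
  then have "ln (1 / s) \<le> 1 / s - 1" using that by (intro ln_le_minus_one) auto
  then have "s * (1 - 1 / s) \<le> s * ln s"
    using that False by (intro mult_left_mono) (auto simp: ln_div)
  then show ?thesis using False that by (simp add: algebra_simps)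
qed auto

text \<open>The negative part of the integrand is at most 1, so its integral is finite on a finite
  measure space, and the norm term is a real number. Only the positive part can diverge, and
  \<open>ennreal\<close> performs that truncation.\<close>

lemma entropy_L2_finite_iff:
  assumes fin: "emeasure M (space M) < \<infinity>"
  shows "\<bar>entropy_L2 M f\<bar> \<noteq> \<infinity> \<longleftrightarrow> (\<integral>\<^sup>+x. ennreal ((cmod (f x))\<^sup>2 * ln ((cmod (f x))\<^sup>2)) \<partial>M) < \<infinity>"
proof -
  let ?P = "\<integral>\<^sup>+x. ennreal ((cmod (f x))\<^sup>2 * ln ((cmod (f x))\<^sup>2)) \<partial>M"
  let ?N = "\<integral>\<^sup>+x. ennreal (- ((cmod (f x))\<^sup>2 * ln ((cmod (f x))\<^sup>2))) \<partial>M"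
  have "?N \<le> (\<integral>\<^sup>+x. 1 \<partial>M)"
  proof (rule nn_integral_mono)
    fix x
    show "ennreal (- ((cmod (f x))\<^sup>2 * ln ((cmod (f x))\<^sup>2))) \<le> 1"
      using entropy_integrand_ge[of "(cmod (f x))\<^sup>2"] by (subst ennreal_le_1) simp
  qed
  also have "\<dots> < \<infinity>" using fin by simp
  finally obtain n where n: "?N = ennreal n" "n \<ge> 0" by (cases ?N) auto
  show ?thesis
  proof (cases ?P)
    case (real p)
    then show ?thesis by (simp add: entropy_L2_def n)
  next
    case top
    then show ?thesis by (simp add: entropy_L2_def n)
  qed
qed

text \<open>Apply \<open>1 + v \<le> exp v\<close> at v = t - ln s and multiply by s. The maximum
  with 0 matches the truncation by \<open>ennreal\<close> in the entropy integral.\<close>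

lemma young_entropy:
  fixes s t :: real
  assumes "s \<ge> 0"
  shows "s * t \<le> max 0 (s * ln s) + exp t"
proof (cases "s = 0")
  case False
  then have s: "s > 0" using assms by simp
  have "s * (1 + (t - ln s)) \<le> s * exp (t - ln s)" using s by (intro mult_left_mono exp_ge_add_one_self) auto
  also have "\<dots> = exp t" using s by (simp add: exp_diff)
  finally have "s * t \<le> s * ln s - s + exp t" by (simp add: algebra_simps)
  then show ?thesis using s by linarith
qed auto

definition nu_measure :: "real \<Rightarrow> real \<Rightarrow> complex measure" where
  "nu_measure \<mu> \<alpha> = density lborel (\<lambda>z. ennreal (nu_density \<mu> \<alpha> z))"

lemma nu_even_eq: "nu_even \<mu> = nu_measure \<mu> (\<mu> - 1/2)"
  and nu_odd_eq: "nu_odd \<mu> = nu_measure \<mu> (\<mu> + 1/2)"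
  by (simp_all add: nu_even_def nu_odd_def nu_measure_def nu_even_density_eq nu_odd_density_eq)

lemma sets_nu_measure [simp, measurable_cong]: "sets (nu_measure \<mu> \<alpha>) = sets borel"
  and space_nu_measure [simp]: "space (nu_measure \<mu> \<alpha>) = UNIV"
  by (simp_all add: nu_measure_def)

lemma nn_integral_nu_measure:
  assumes [measurable]: "g \<in> borel_measurable borel"
  shows "(\<integral>\<^sup>+z. g z \<partial>nu_measure \<mu> \<alpha>) = (\<integral>\<^sup>+z. ennreal (nu_density \<mu> \<alpha> z) * g z \<partial>lborel)"
  by (simp add: nu_measure_def nn_integral_density)

context
  fixes \<mu> :: real
  assumes \<mu>: "\<mu> > - 1/2"
begin

lemma emeasure_nu_measure_finite:
  assumes "\<bar>\<alpha>\<bar> < \<mu> + 3/2"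
  shows "emeasure (nu_measure \<mu> \<alpha>) UNIV < \<infinity>"
  using nn_integral_nu_density_finite[OF \<mu> assms]
  by (simp add: nu_measure_def emeasure_density)

text \<open>Off the unit disc \<open>macdonald_comparable\<close> bounds one density by a multiple
  of the other. On the disc the integrand is bounded by continuity, and the target measure is
  finite.\<close>

lemma weighted_L2_finite_transfer:
  assumes \<alpha>: "\<bar>\<alpha>\<bar> < \<mu> + 3/2" and f: "continuous_on UNIV f"
    and fin: "(\<integral>\<^sup>+z. ennreal ((cmod (z * f z))\<^sup>2) \<partial>nu_measure \<mu> \<beta>) < \<infinity>"
  shows "(\<integral>\<^sup>+z. ennreal ((cmod (z * f z))\<^sup>2) \<partial>nu_measure \<mu> \<alpha>) < \<infinity>"
proof -
  let ?g = "\<lambda>z. (cmod (z * f z))\<^sup>2"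
  have [measurable]: "f \<in> borel_measurable borel" using f by (rule borel_measurable_continuous_onI)
  obtain C where C: "C > 0" "\<And>x. x \<ge> 1 \<Longrightarrow> macdonald \<alpha> x \<le> C * macdonald \<beta> x"
    using macdonald_comparable[of \<alpha> \<beta>] by blast
  have "continuous_on (cball 0 1) ?g"
    using continuous_on_subset[OF f, of "cball 0 1"] by (intro continuous_intros) auto
  then have "\<exists>w\<in>cball 0 1. \<forall>z\<in>cball 0 1. ?g z \<le> ?g w"
    by (intro continuous_attains_sup) auto
  then obtain w where "\<And>z. z \<in> cball 0 1 \<Longrightarrow> ?g z \<le> ?g w" by blast
  then have w: "?g z \<le> ?g w" if "cmod z \<le> 1" for z using that by (simp only: mem_cball_0)
  define B where "B = ?g w"
  have B: "B \<ge> 0" by (simp add: B_def)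
  have le: "ennreal (nu_density \<mu> \<alpha> z) * ennreal (?g z) \<le>
      ennreal B * ennreal (nu_density \<mu> \<alpha> z) + ennreal C * (ennreal (nu_density \<mu> \<beta> z) * ennreal (?g z))" for z
  proof -
    have "nu_density \<mu> \<alpha> z * ?g z \<le> B * nu_density \<mu> \<alpha> z + C * (nu_density \<mu> \<beta> z * ?g z)"
    proof (cases "cmod z \<le> 1")
      case True
      then have "?g z \<le> B" unfolding B_def by (rule w)
      then have "nu_density \<mu> \<alpha> z * ?g z \<le> nu_density \<mu> \<alpha> z * B"
        by (rule mult_left_mono) (rule nu_density_nonneg[OF \<mu>])
      moreover have "0 \<le> C * (nu_density \<mu> \<beta> z * ?g z)"
        using C(1) nu_density_nonneg[OF \<mu>, of \<beta> z] by simp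
      ultimately show ?thesis by (simp only: mult.commute[of B] add_increasing2)
    next
      case False
      then have "1 \<le> (cmod z)\<^sup>2" by (simp add: one_le_power)
      then have "macdonald \<alpha> ((cmod z)\<^sup>2) \<le> C * macdonald \<beta> ((cmod z)\<^sup>2)" by (rule C(2))
      then have "nu_density \<mu> \<alpha> z \<le> 2 powr (1/2 - \<mu>) / (pi * Gamma (\<mu> + 1/2))
          * (C * macdonald \<beta> ((cmod z)\<^sup>2)) * cmod z powr (2 * \<mu> + 1)"
        unfolding nu_density_def using nu_const_pos[OF \<mu>]
        by (intro mult_right_mono mult_left_mono) (auto simp: less_imp_le)
      also have "\<dots> = C * nu_density \<mu> \<beta> z" by (simp add: nu_density_def)
      finally have "nu_density \<mu> \<alpha> z * ?g z \<le> C * nu_density \<mu> \<beta> z * ?g z" by (rule mult_right_mono) simp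
      moreover have "0 \<le> B * nu_density \<mu> \<alpha> z"
        using B nu_density_nonneg[OF \<mu>, of \<alpha> z] by simp
      ultimately show ?thesis by (simp only: mult.assoc add_increasing)
    qed
    then show ?thesis using B C(1) nu_density_nonneg[OF \<mu>]
      by (simp add: ennreal_leI flip: ennreal_mult ennreal_plus)
  qed
  have "(\<integral>\<^sup>+z. ennreal (?g z) \<partial>nu_measure \<mu> \<alpha>) = (\<integral>\<^sup>+z. ennreal (nu_density \<mu> \<alpha> z) * ennreal (?g z) \<partial>lborel)"
    by (rule nn_integral_nu_measure) measurable
  also have "\<dots> \<le> (\<integral>\<^sup>+z. ennreal B * ennreal (nu_density \<mu> \<alpha> z) + ennreal C * (ennreal (nu_density \<mu> \<beta> z) * ennreal (?g z)) \<partial>lborel)"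
    by (rule nn_integral_mono) (rule le)
  also have "\<dots> = ennreal B * (\<integral>\<^sup>+z. ennreal (nu_density \<mu> \<alpha> z) \<partial>lborel) +
      ennreal C * (\<integral>\<^sup>+z. ennreal (nu_density \<mu> \<beta> z) * ennreal (?g z) \<partial>lborel)"
    by (simp add: nn_integral_add nn_integral_cmult)
  also have "(\<integral>\<^sup>+z. ennreal (nu_density \<mu> \<beta> z) * ennreal (?g z) \<partial>lborel) = (\<integral>\<^sup>+z. ennreal (?g z) \<partial>nu_measure \<mu> \<beta>)"
    by (rule nn_integral_nu_measure[symmetric]) measurable
  finally show ?thesis
    using fin nn_integral_nu_density_finite[OF \<mu> \<alpha>]
    by (auto simp: ennreal_mult_less_top elim!: order.strict_trans1)
qed

text \<open>Far from the origin, |f(z)|^2 is controlled by its integral over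
  \<open>ball z 1\<close>, and \<open>macdonald_ge\<close> bounds the density there from below by a
  Gaussian in |z| + 1. Near the origin continuity suffices.\<close>

lemma entire_L2_growth:
  assumes f: "f holomorphic_on UNIV"
    and fin: "(\<integral>\<^sup>+z. ennreal ((cmod (f z))\<^sup>2) \<partial>nu_measure \<mu> \<alpha>) < \<infinity>"
  obtains A B where "A \<ge> 0" "B \<ge> 0" "\<And>z. (cmod (f z))\<^sup>2 \<le> exp (A + B * (cmod z)\<^sup>2)"
proof -
  have [measurable]: "f \<in> borel_measurable borel" using f by (rule borel_measurable_entire)
  obtain Q where Q: "(\<integral>\<^sup>+z. ennreal ((cmod (f z))\<^sup>2) \<partial>nu_measure \<mu> \<alpha>) = ennreal Q" "Q \<ge> 0"
    using fin by (cases "\<integral>\<^sup>+z. ennreal ((cmod (f z))\<^sup>2) \<partial>nu_measure \<mu> \<alpha>") auto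
  define c where "c = 2 powr (1/2 - \<mu>) / (pi * Gamma (\<mu> + 1/2))"
  have c: "c > 0" unfolding c_def by (rule nu_const_pos[OF \<mu>])
  have "continuous_on (cball 0 2) (\<lambda>z. (cmod (f z))\<^sup>2)"
    using holomorphic_on_imp_continuous_on[OF f, THEN continuous_on_subset, of "cball 0 2"]
    by (intro continuous_intros) auto
  then have "\<exists>w\<in>cball 0 2. \<forall>z\<in>cball 0 2. (cmod (f z))\<^sup>2 \<le> (cmod (f w))\<^sup>2"
    by (intro continuous_attains_sup) auto
  then obtain w where "\<And>z. z \<in> cball 0 2 \<Longrightarrow> (cmod (f z))\<^sup>2 \<le> (cmod (f w))\<^sup>2" by blast
  then have w: "(cmod (f z))\<^sup>2 \<le> (cmod (f w))\<^sup>2" if "cmod z \<le> 2" for z using that by (simp only: mem_cball_0)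
  have far: "(cmod (f z))\<^sup>2 \<le> Q / (pi * c) * exp ((cmod z + 1)\<^sup>2 * cosh 1)" if z: "cmod z \<ge> 2" for z
  proof -
    have [measurable]: "ball z 1 \<in> sets borel" by simp
    define m where "m = c * exp (- ((cmod z + 1)\<^sup>2 * cosh 1))"
    have m: "m > 0" using c by (simp add: m_def)
    have dens: "m \<le> nu_density \<mu> \<alpha> v" if "v \<in> ball z 1" for v
    proof -
      \<comment> \<open>The choice |z| \<ge> 2 keeps the ball outside the open unit disc, so the
        power of |v| in the density, whose exponent is positive, is at least 1.\<close>
      have v1: "1 \<le> cmod v" "cmod v \<le> cmod z + 1"
        using that z norm_triangle_ineq2[of z v] norm_triangle_ineq2[of v z]
        by (auto simp: dist_norm norm_minus_commute)
      have "(cmod v)\<^sup>2 * cosh 1 \<le> (cmod z + 1)\<^sup>2 * cosh 1"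
        using v1 by (intro mult_right_mono power_mono) auto
      then have "exp (- ((cmod z + 1)\<^sup>2 * cosh 1)) \<le> exp (- ((cmod v)\<^sup>2 * cosh 1))" by simp
      also have "\<dots> \<le> macdonald \<alpha> ((cmod v)\<^sup>2)"
        using macdonald_ge[of "(cmod v)\<^sup>2" \<alpha>] v1 by (cases "v = 0") auto
      finally have "m * 1 \<le> (c * macdonald \<alpha> ((cmod v)\<^sup>2)) * cmod v powr (2 * \<mu> + 1)"
        unfolding m_def using v1 c \<mu> macdonald_nonneg[of \<alpha> "(cmod v)\<^sup>2"]
        by (intro mult_mono mult_left_mono ge_one_powr_ge_zero mult_nonneg_nonneg) auto
      then show ?thesis by (simp add: nu_density_def c_def)
    qed
    have "ennreal m * ennreal (pi * (cmod (f z))\<^sup>2) \<le>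
        ennreal m * (\<integral>\<^sup>+v. indicator (ball z 1) v * ennreal ((cmod (f v))\<^sup>2) \<partial>lborel)"
      by (intro mult_left_mono entire_sub_mean_value f) auto
    also have "\<dots> = (\<integral>\<^sup>+v. ennreal m * (indicator (ball z 1) v * ennreal ((cmod (f v))\<^sup>2)) \<partial>lborel)"
      by (rule nn_integral_cmult[symmetric]) measurable
    also have "\<dots> \<le> (\<integral>\<^sup>+v. ennreal (nu_density \<mu> \<alpha> v) * ennreal ((cmod (f v))\<^sup>2) \<partial>lborel)"
    proof (rule nn_integral_mono)
      fix v
      show "ennreal m * (indicator (ball z 1) v * ennreal ((cmod (f v))\<^sup>2)) \<le> ennreal (nu_density \<mu> \<alpha> v) * ennreal ((cmod (f v))\<^sup>2)"
        using dens[of v] by (cases "v \<in> ball z 1") (auto intro!: mult_right_mono ennreal_leI)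
    qed
    also have "\<dots> = ennreal Q"
      using Q by (subst nn_integral_nu_measure[symmetric]) auto
    finally have "m * (pi * (cmod (f z))\<^sup>2) \<le> Q"
      using m Q(2) by (simp flip: ennreal_mult)
    then have "(cmod (f z))\<^sup>2 \<le> Q / (pi * m)" using m by (simp add: field_simps)
    also have "\<dots> = Q / (pi * c) * exp ((cmod z + 1)\<^sup>2 * cosh 1)"
      by (simp add: m_def exp_minus field_simps)
    finally show ?thesis .
  qed
  \<comment> \<open>The 2 comes from (|z| + 1)^2 \<le> 2 (1 + |z|^2). Below, D majorizes the
    constants of both regions, and its summand 1 makes \<open>ln D\<close> nonnegative.\<close>
  define K where "K = 2 * cosh (1::real)"
  have K: "K \<ge> 0" by (simp add: K_def)
  define D where "D = 1 + Q / (pi * c) + (cmod (f w))\<^sup>2"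
  have D: "D \<ge> 1" using Q(2) c by (simp add: D_def)
  have bound: "(cmod (f z))\<^sup>2 \<le> D * exp (K * (1 + (cmod z)\<^sup>2))" for z
  proof (cases "cmod z \<le> 2")
    case True
    then have "(cmod (f z))\<^sup>2 \<le> (cmod (f w))\<^sup>2" by (rule w)
    also have "\<dots> \<le> D * 1" using Q(2) c by (simp add: D_def)
    also have "\<dots> \<le> D * exp (K * (1 + (cmod z)\<^sup>2))" using K D by (intro mult_left_mono) auto
    finally show ?thesis .
  next
    case False
    have "(cmod z + 1)\<^sup>2 \<le> 2 * (1 + (cmod z)\<^sup>2)"
      using zero_le_power2[of "cmod z - 1"] by (simp add: power2_eq_square algebra_simps)
    then have "(cmod z + 1)\<^sup>2 * cosh 1 \<le> 2 * (1 + (cmod z)\<^sup>2) * cosh 1" by (rule mult_right_mono) simp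
    then have "exp ((cmod z + 1)\<^sup>2 * cosh 1) \<le> exp (K * (1 + (cmod z)\<^sup>2))" by (simp add: K_def mult_ac)
    then have "Q / (pi * c) * exp ((cmod z + 1)\<^sup>2 * cosh 1) \<le> D * exp (K * (1 + (cmod z)\<^sup>2))"
      using Q(2) c by (intro mult_mono) (auto simp: D_def)
    then show ?thesis using far[of z] False by simp
  qed
  show thesis
  proof
    show "ln D + K \<ge> 0" "K \<ge> 0" using D K by simp_all
    show "(cmod (f z))\<^sup>2 \<le> exp (ln D + K + K * (cmod z)\<^sup>2)" for z
      using bound[of z] D by (simp add: exp_add algebra_simps)
  qed
qed

lemma entropy_integral_finite_iff:
  assumes \<alpha>: "\<bar>\<alpha>\<bar> < \<mu> + 3/2" and f: "f holomorphic_on UNIV"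
    and fin: "(\<integral>\<^sup>+z. ennreal ((cmod (f z))\<^sup>2) \<partial>nu_measure \<mu> \<alpha>) < \<infinity>"
  shows "(\<integral>\<^sup>+z. ennreal ((cmod (f z))\<^sup>2 * ln ((cmod (f z))\<^sup>2)) \<partial>nu_measure \<mu> \<alpha>) < \<infinity> \<longleftrightarrow>
    (\<integral>\<^sup>+z. ennreal ((cmod (z * f z))\<^sup>2) \<partial>nu_measure \<mu> \<alpha>) < \<infinity>"
proof
  have [measurable]: "f \<in> borel_measurable borel" using f by (rule borel_measurable_entire)
  let ?s = "\<lambda>z. (cmod (f z))\<^sup>2"
  {
    assume ent: "(\<integral>\<^sup>+z. ennreal (?s z * ln (?s z)) \<partial>nu_measure \<mu> \<alpha>) < \<infinity>"
    have "(\<integral>\<^sup>+z. ennreal ((cmod (z * f z))\<^sup>2) \<partial>nu_measure \<mu> \<alpha>) \<le>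
        (\<integral>\<^sup>+z. 2 * (ennreal (?s z * ln (?s z)) + ennreal (exp ((cmod z)\<^sup>2 / 2))) \<partial>nu_measure \<mu> \<alpha>)"
    proof (rule nn_integral_mono)
      fix z
      have "(cmod (z * f z))\<^sup>2 \<le> 2 * (max 0 (?s z * ln (?s z)) + exp ((cmod z)\<^sup>2 / 2))"
      proof -
        \<comment> \<open>The factor 2 compensates for t = |z|^2 / 2 in Young's inequality, a choice
          for which exp t is integrable.\<close>
        have "(cmod (z * f z))\<^sup>2 = 2 * (?s z * ((cmod z)\<^sup>2 / 2))"
          by (simp add: norm_mult power_mult_distrib)
        then show ?thesis
          using young_entropy[OF zero_le_power2[of "cmod (f z)"], of "(cmod z)\<^sup>2 / 2"] by (simp only: mult_le_cancel_left_pos zero_less_numeral)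
      qed
      then have "ennreal ((cmod (z * f z))\<^sup>2) \<le> ennreal (2 * (max 0 (?s z * ln (?s z)) + exp ((cmod z)\<^sup>2 / 2)))"
        by (rule ennreal_leI)
      also have "\<dots> = 2 * (ennreal (max 0 (?s z * ln (?s z))) + ennreal (exp ((cmod z)\<^sup>2 / 2)))"
        by (subst ennreal_mult) (auto simp: ennreal_plus)
      also have "ennreal (max 0 (?s z * ln (?s z))) = ennreal (?s z * ln (?s z))"
        by (simp add: max_def ennreal_neg)
      finally show "ennreal ((cmod (z * f z))\<^sup>2) \<le> 2 * (ennreal (?s z * ln (?s z)) + ennreal (exp ((cmod z)\<^sup>2 / 2)))" .
    qed
    also have "\<dots> = 2 * ((\<integral>\<^sup>+z. ennreal (?s z * ln (?s z)) \<partial>nu_measure \<mu> \<alpha>) + (\<integral>\<^sup>+z. ennreal (exp ((cmod z)\<^sup>2 / 2)) \<partial>nu_measure \<mu> \<alpha>))"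
      by (simp add: nn_integral_cmult nn_integral_add)
    also have "\<dots> < \<infinity>"
      using ent nn_integral_nu_density_exp_finite[OF \<mu> \<alpha>]
      by (simp add: ennreal_mult_less_top nn_integral_nu_measure)
    finally show "(\<integral>\<^sup>+z. ennreal ((cmod (z * f z))\<^sup>2) \<partial>nu_measure \<mu> \<alpha>) < \<infinity>" .
  next
    assume w: "(\<integral>\<^sup>+z. ennreal ((cmod (z * f z))\<^sup>2) \<partial>nu_measure \<mu> \<alpha>) < \<infinity>"
    obtain A B where AB: "A \<ge> 0" "B \<ge> 0" "\<And>z. ?s z \<le> exp (A + B * (cmod z)\<^sup>2)"
      using entire_L2_growth[OF f fin] by blast
    have "(\<integral>\<^sup>+z. ennreal (?s z * ln (?s z)) \<partial>nu_measure \<mu> \<alpha>) \<le>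
        (\<integral>\<^sup>+z. ennreal A * ennreal (?s z) + ennreal B * ennreal ((cmod (z * f z))\<^sup>2) \<partial>nu_measure \<mu> \<alpha>)"
    proof (rule nn_integral_mono)
      fix z
      have "?s z * ln (?s z) \<le> ?s z * (A + B * (cmod z)\<^sup>2)"
      proof (cases "f z = 0")
        case False
        then have "ln (?s z) \<le> ln (exp (A + B * (cmod z)\<^sup>2))" by (intro ln_mono AB(3)) auto
        then show ?thesis by (intro mult_left_mono) auto
      qed auto
      also have "\<dots> = A * ?s z + B * (cmod (z * f z))\<^sup>2"
        by (simp add: norm_mult power_mult_distrib algebra_simps)
      finally show "ennreal (?s z * ln (?s z)) \<le> ennreal A * ennreal (?s z) + ennreal B * ennreal ((cmod (z * f z))\<^sup>2)"
        using AB(1,2) by (simp add: ennreal_leI flip: ennreal_mult ennreal_plus)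
    qed
    also have "\<dots> = ennreal A * (\<integral>\<^sup>+z. ennreal (?s z) \<partial>nu_measure \<mu> \<alpha>) + ennreal B * (\<integral>\<^sup>+z. ennreal ((cmod (z * f z))\<^sup>2) \<partial>nu_measure \<mu> \<alpha>)"
      by (simp add: nn_integral_cmult nn_integral_add)
    also have "\<dots> < \<infinity>" using fin w by (simp add: ennreal_mult_less_top)
    finally show "(\<integral>\<^sup>+z. ennreal (?s z * ln (?s z)) \<partial>nu_measure \<mu> \<alpha>) < \<infinity>" .
  }
qed

end

section \<open>Dirichlet energy and the weighted norm\<close>

lemma suminf_ennreal_Suc:
  fixes F :: "nat \<Rightarrow> ennreal"
  assumes "F 0 = 0"
  shows "(\<Sum>n. F n) = (\<Sum>n. F (Suc n))"
  using suminf_offset[of F 1] assms by simp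

lemma sums_mult_z:
  fixes s z :: complex
  assumes "(\<lambda>n. a n * z ^ n) sums s"
  shows "(\<lambda>n. (case n of 0 \<Rightarrow> 0 | Suc m \<Rightarrow> a m) * z ^ n) sums (z * s)"
proof -
  have "(\<lambda>n. z * (a n * z ^ n)) sums (z * s)" using assms by (rule sums_mult)
  then have "(\<lambda>n. (case Suc n of 0 \<Rightarrow> 0 | Suc m \<Rightarrow> a m) * z ^ Suc n) sums (z * s)"
    by (simp add: mult_ac)
  then show ?thesis by (subst (asm) sums_Suc_iff) simp
qed

lemma entire_taylor_coeffs:
  assumes f: "f holomorphic_on UNIV"
  obtains a where "\<And>z. (\<lambda>n. a n * z ^ n) sums f z" "\<And>z. (\<lambda>n. (of_nat (Suc n) * a (Suc n)) * z ^ n) sums deriv f z"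
proof
  let ?a = "\<lambda>n. (deriv ^^ n) f 0 / fact n"
  show "(\<lambda>n. ?a n * z ^ n) sums f z" for z using entire_sums[OF f, of 0 z] by simp
  have df: "deriv f holomorphic_on UNIV" using f by (rule holomorphic_deriv) simp
  have "(deriv ^^ n) (deriv f) 0 / fact n = of_nat (Suc n) * ?a (Suc n)" for n
    by (simp add: funpow_swap1 del: of_nat_Suc)
  then show "(\<lambda>n. (of_nat (Suc n) * ?a (Suc n)) * z ^ n) sums deriv f z" for z
    using entire_sums[OF df, of 0 z] by (simp only:) simp
qed

context
  fixes \<mu> :: real
  assumes \<mu>: "\<mu> > - 1/2"
begin

lemma nn_integral_nu_measure_power_series:
  assumes "\<bar>\<alpha>\<bar> < \<mu> + 3/2" and f: "\<And>z. (\<lambda>n. a n * z ^ n) sums f z"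
  shows "(\<integral>\<^sup>+z. ennreal ((cmod (f z))\<^sup>2) \<partial>nu_measure \<mu> \<alpha>) = (\<Sum>n. ennreal ((cmod (a n))\<^sup>2 * nu_moment \<mu> \<alpha> n))"
proof -
  have "f = (\<lambda>z. \<Sum>n. a n * z ^ n)" using f by (auto simp: sums_iff)
  then have [measurable]: "f \<in> borel_measurable borel" by simp
  show ?thesis
    by (simp add: nn_integral_nu_measure nn_integral_nu_density_power_series[OF \<mu> assms])
qed

lemma nn_integral_nu_measure_power_series_mult:
  assumes "\<bar>\<alpha>\<bar> < \<mu> + 3/2" and f: "\<And>z. (\<lambda>n. a n * z ^ n) sums f z"
  shows "(\<integral>\<^sup>+z. ennreal ((cmod (z * f z))\<^sup>2) \<partial>nu_measure \<mu> \<alpha>) = (\<Sum>n. ennreal ((cmod (a n))\<^sup>2 * nu_moment \<mu> \<alpha> (Suc n)))"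
proof -
  have "(\<lambda>n. (case n of 0 \<Rightarrow> 0 | Suc m \<Rightarrow> a m) * z ^ n) sums (z * f z)" for z
    by (rule sums_mult_z[OF f])
  from nn_integral_nu_measure_power_series[where f = "\<lambda>z. z * f z", OF assms(1) this]
  show ?thesis by (simp add: suminf_ennreal_Suc)
qed

lemma admissible: "\<bar>\<mu> - 1/2\<bar> < \<mu> + 3/2" "\<bar>\<mu> + 1/2\<bar> < \<mu> + 3/2"
  using \<mu> by (auto simp: abs_if)

text \<open>Compare coefficients. The n-th term on the left is (n + 1 + 2\<mu>) |a_n|^2 e_n; the
  derivative contributes n |a_n|^2 e_n, because (n + 1)^2 o_n = (n + 1) e_(n+1). For the even part
  of a function, \<open>deriv g\<close> is the odd part of its deformed derivative.\<close>

lemma dirichlet_identity_even: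
  assumes g: "g holomorphic_on UNIV"
  shows "(\<integral>\<^sup>+z. ennreal ((cmod (z * g z))\<^sup>2) \<partial>nu_odd \<mu>) =
    (\<integral>\<^sup>+z. ennreal ((cmod (deriv g z))\<^sup>2) \<partial>nu_odd \<mu>)
    + ennreal (1 + 2 * \<mu>) * (\<integral>\<^sup>+z. ennreal ((cmod (g z))\<^sup>2) \<partial>nu_even \<mu>)"
proof -
  let ?e = "nu_moment \<mu> (\<mu> - 1/2)" and ?o = "nu_moment \<mu> (\<mu> + 1/2)"
  obtain a where a: "\<And>z. (\<lambda>n. a n * z ^ n) sums g z"
      "\<And>z. (\<lambda>n. (of_nat (Suc n) * a (Suc n)) * z ^ n) sums deriv g z"
    by (rule entire_taylor_coeffs[OF g]) (rule that)
  have "(\<integral>\<^sup>+z. ennreal ((cmod (deriv g z))\<^sup>2) \<partial>nu_odd \<mu>) =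
      (\<Sum>n. ennreal ((cmod (of_nat (Suc n) * a (Suc n)))\<^sup>2 * ?o n))"
    unfolding nu_odd_eq by (rule nn_integral_nu_measure_power_series[OF admissible(2) a(2)])
  also have "\<dots> = (\<Sum>n. ennreal (real (Suc n) * (cmod (a (Suc n)))\<^sup>2 * ?e (Suc n)))"
    by (intro suminf_cong arg_cong[where f = ennreal])
       (simp add: nu_moment_even_Suc[OF \<mu>] norm_mult power_mult_distrib power2_eq_square mult_ac add_ac flip: of_nat_Suc)
  also have "\<dots> = (\<Sum>n. ennreal (real n * (cmod (a n))\<^sup>2 * ?e n))"
    by (rule suminf_ennreal_Suc[symmetric]) simp
  finally have deriv: "(\<integral>\<^sup>+z. ennreal ((cmod (deriv g z))\<^sup>2) \<partial>nu_odd \<mu>) = \<dots>" .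
  have "(\<integral>\<^sup>+z. ennreal ((cmod (z * g z))\<^sup>2) \<partial>nu_odd \<mu>) = (\<Sum>n. ennreal ((cmod (a n))\<^sup>2 * ?o (Suc n)))"
    unfolding nu_odd_eq by (rule nn_integral_nu_measure_power_series_mult[OF admissible(2) a(1)])
  also have "\<dots> = (\<Sum>n. ennreal (real n * (cmod (a n))\<^sup>2 * ?e n) + ennreal (1 + 2 * \<mu>) * ennreal ((cmod (a n))\<^sup>2 * ?e n))"
  proof (intro suminf_cong)
    fix n
    have "(cmod (a n))\<^sup>2 * ?o (Suc n) = real n * (cmod (a n))\<^sup>2 * ?e n + (1 + 2 * \<mu>) * ((cmod (a n))\<^sup>2 * ?e n)"
      by (simp add: nu_moment_odd_Suc[OF \<mu>] algebra_simps)
    then show "ennreal ((cmod (a n))\<^sup>2 * ?o (Suc n)) = ennreal (real n * (cmod (a n))\<^sup>2 * ?e n) + ennreal (1 + 2 * \<mu>) * ennreal ((cmod (a n))\<^sup>2 * ?e n)"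
      using \<mu> nu_moment_nonneg[OF \<mu>] by (simp flip: ennreal_mult ennreal_plus)
  qed
  also have "\<dots> = (\<Sum>n. ennreal (real n * (cmod (a n))\<^sup>2 * ?e n)) + ennreal (1 + 2 * \<mu>) * (\<Sum>n. ennreal ((cmod (a n))\<^sup>2 * ?e n))"
    by (simp add: suminf_add[symmetric])
  finally show ?thesis
    unfolding deriv nu_even_eq nn_integral_nu_measure_power_series[OF admissible(1) a(1)] .
qed

text \<open>In the coefficients a_n of q, every term is a multiple of |a_n|^2 o_(n+1), and the
  identity reads (n + 2) + (1 + 2\<mu>) = (n + 1 + 2\<mu>) + 2. Corrections are added on both sides
  because 1 - 2\<mu> may be negative and the integrals may be infinite.\<close>

lemma dirichlet_identity_odd:
  assumes q: "q holomorphic_on UNIV" and h: "h = (\<lambda>z. z * q z)"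
  shows "(\<integral>\<^sup>+z. ennreal ((cmod (z * h z))\<^sup>2) \<partial>nu_even \<mu>)
    + ennreal (1 + 2 * \<mu>) * (\<integral>\<^sup>+z. ennreal ((cmod (h z))\<^sup>2) \<partial>nu_odd \<mu>) =
    (\<integral>\<^sup>+z. ennreal ((cmod (deriv h z + of_real (2 * \<mu>) * q z))\<^sup>2) \<partial>nu_even \<mu>)
    + 2 * (\<integral>\<^sup>+z. ennreal ((cmod (h z))\<^sup>2) \<partial>nu_odd \<mu>)"
proof -
  let ?e = "nu_moment \<mu> (\<mu> - 1/2)" and ?o = "nu_moment \<mu> (\<mu> + 1/2)"
  obtain a where a: "\<And>z. (\<lambda>n. a n * z ^ n) sums q z"
      "\<And>z. (\<lambda>n. (of_nat (Suc n) * a (Suc n)) * z ^ n) sums deriv q z"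
    by (rule entire_taylor_coeffs[OF q]) (rule that)
  let ?c = "\<lambda>n. case n of 0 \<Rightarrow> 0 | Suc m \<Rightarrow> a m"
  have c: "(\<lambda>n. ?c n * z ^ n) sums h z" for z
    unfolding h by (rule sums_mult_z[OF a(1)])
  have D: "(\<lambda>n. (of_real (real n + 1 + 2 * \<mu>) * a n) * z ^ n) sums (deriv h z + of_real (2 * \<mu>) * q z)" for z
  proof -
    have "deriv h z = q z + z * deriv q z"
      unfolding h using q by (intro DERIV_imp_deriv)
        (auto intro!: derivative_eq_intros holomorphic_derivI[of q UNIV])
    then have d: "(1 + 2 * of_real \<mu>) * q z + z * deriv q z = deriv h z + of_real (2 * \<mu>) * q z"
      by (simp add: algebra_simps)
    have eq: "(1 + 2 * of_real \<mu>) * (a n * z ^ n) + (case n of 0 \<Rightarrow> 0 | Suc m \<Rightarrow> of_nat (Suc m) * a (Suc m)) * z ^ n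
        = (of_real (real n + 1 + 2 * \<mu>) * a n) * z ^ n" for n
      by (cases n) (simp_all add: algebra_simps)
    have "(\<lambda>n. (1 + 2 * of_real \<mu>) * (a n * z ^ n) + (case n of 0 \<Rightarrow> 0 | Suc m \<Rightarrow> of_nat (Suc m) * a (Suc m)) * z ^ n)
        sums ((1 + 2 * of_real \<mu>) * q z + z * deriv q z)"
      by (intro sums_add sums_mult a(1) sums_mult_z a(2))
    then show ?thesis unfolding eq d .
  qed
  have E: "(\<integral>\<^sup>+z. ennreal ((cmod (deriv h z + of_real (2 * \<mu>) * q z))\<^sup>2) \<partial>nu_even \<mu>) = (\<Sum>n. ennreal ((real n + 1 + 2 * \<mu>) * (cmod (a n))\<^sup>2 * ?o (Suc n)))"
    unfolding nu_even_eq nn_integral_nu_measure_power_series[OF admissible(1) D]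
    by (intro suminf_cong arg_cong[where f = ennreal])
       (simp add: nu_moment_odd_Suc[OF \<mu>] norm_mult power_mult_distrib power2_eq_square mult_ac del: of_real_add of_real_mult)
  have H: "(\<integral>\<^sup>+z. ennreal ((cmod (h z))\<^sup>2) \<partial>nu_odd \<mu>) = (\<Sum>n. ennreal ((cmod (a n))\<^sup>2 * ?o (Suc n)))"
    unfolding nu_odd_eq h by (rule nn_integral_nu_measure_power_series_mult[OF admissible(2) a(1)])
  have "(\<integral>\<^sup>+z. ennreal ((cmod (z * h z))\<^sup>2) \<partial>nu_even \<mu>) = (\<Sum>n. ennreal ((cmod (?c n))\<^sup>2 * ?e (Suc n)))"
    unfolding nu_even_eq by (rule nn_integral_nu_measure_power_series_mult[OF admissible(1) c])
  \<comment> \<open>The constant coefficient of h is 0, so the sum starts at index 1; this shift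
    comes on top of the one due to the factor z.\<close>
  also have "\<dots> = (\<Sum>n. ennreal ((cmod (a n))\<^sup>2 * ?e (Suc (Suc n))))"
    by (subst suminf_ennreal_Suc) simp_all
  also have "\<dots> = (\<Sum>n. ennreal ((real n + 2) * (cmod (a n))\<^sup>2 * ?o (Suc n)))"
    by (intro suminf_cong arg_cong[where f = ennreal]) (simp add: nu_moment_even_Suc[OF \<mu>] algebra_simps)
  finally have Z: "(\<integral>\<^sup>+z. ennreal ((cmod (z * h z))\<^sup>2) \<partial>nu_even \<mu>) = \<dots>" .
  have "ennreal ((real n + 2) * (cmod (a n))\<^sup>2 * ?o (Suc n)) + ennreal (1 + 2 * \<mu>) * ennreal ((cmod (a n))\<^sup>2 * ?o (Suc n)) =
      ennreal ((real n + 1 + 2 * \<mu>) * (cmod (a n))\<^sup>2 * ?o (Suc n)) + ennreal 2 * ennreal ((cmod (a n))\<^sup>2 * ?o (Suc n))" for n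
  proof -
    have nonneg: "0 \<le> (cmod (a n))\<^sup>2 * ?o (Suc n)" using nu_moment_nonneg[OF \<mu>] by simp
    have "ennreal (real n + 2) + ennreal (1 + 2 * \<mu>) = ennreal (real n + 1 + 2 * \<mu>) + ennreal 2"
      using \<mu> by (simp flip: ennreal_plus del: ennreal_numeral)
    then show ?thesis
      by (simp only: mult.assoc ennreal_mult''[OF nonneg] flip: distrib_right)
  qed
  then have "(\<Sum>n. ennreal ((real n + 2) * (cmod (a n))\<^sup>2 * ?o (Suc n))) + ennreal (1 + 2 * \<mu>) * (\<Sum>n. ennreal ((cmod (a n))\<^sup>2 * ?o (Suc n))) =
      (\<Sum>n. ennreal ((real n + 1 + 2 * \<mu>) * (cmod (a n))\<^sup>2 * ?o (Suc n))) + ennreal 2 * (\<Sum>n. ennreal ((cmod (a n))\<^sup>2 * ?o (Suc n)))"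
    by (simp only: ennreal_suminf_cmult[symmetric] suminf_add[OF summableI summableI])
  then show ?thesis unfolding E H Z by simp
qed

end

section \<open>Parity parts, the deformed derivative and the two-sheeted measure\<close>

lemma in_L2_nu_measure_iff:
  assumes "f holomorphic_on UNIV"
  shows "in_L2 (nu_measure \<mu> \<alpha>) f \<longleftrightarrow> (\<integral>\<^sup>+z. ennreal ((cmod (f z))\<^sup>2) \<partial>nu_measure \<mu> \<alpha>) < \<infinity>"
proof -
  have [measurable]: "f \<in> borel_measurable borel" using assms by (rule borel_measurable_entire)
  show ?thesis by (simp add: in_L2_def integrable_iff_bounded)
qed

lemma holomorphic_parity_parts:
  assumes "f holomorphic_on UNIV"
  shows "even_part f holomorphic_on UNIV" "odd_part f holomorphic_on UNIV"
proof -
  have "(\<lambda>z. f (- z)) holomorphic_on UNIV"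
    using holomorphic_on_compose_gen[of uminus UNIV f UNIV] assms by (simp add: o_def holomorphic_on_minus)
  then show "even_part f holomorphic_on UNIV" "odd_part f holomorphic_on UNIV"
    using assms unfolding even_part_def[abs_def] odd_part_def[abs_def]
    by (auto intro!: holomorphic_intros)
qed

lemma deriv_parity_parts:
  assumes f: "f holomorphic_on UNIV"
  shows "deriv (even_part f) = odd_part (deriv f)" "deriv (odd_part f) = even_part (deriv f)"
proof -
  have d: "(f has_field_derivative deriv f z) (at z)" for z
    using f by (intro holomorphic_derivI[of f UNIV]) auto
  have d': "((\<lambda>z. f (- z)) has_field_derivative - deriv f (- z)) (at z)" for z
  proof -
    have "((\<lambda>z. - z) has_field_derivative - 1) (at z)" by (auto intro!: derivative_eq_intros)
    from DERIV_chain2[OF d this] show ?thesis by simp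
  qed
  have "(even_part f has_field_derivative odd_part (deriv f) z) (at z)" for z
    unfolding even_part_def[abs_def] odd_part_def
    by (rule derivative_eq_intros d d' refl | simp)+
  then show "deriv (even_part f) = odd_part (deriv f)" by (auto intro!: DERIV_imp_deriv)
  have "(odd_part f has_field_derivative even_part (deriv f) z) (at z)" for z
    unfolding odd_part_def[abs_def] even_part_def
    by (rule derivative_eq_intros d d' refl | simp)+
  then show "deriv (odd_part f) = even_part (deriv f)" by (auto intro!: DERIV_imp_deriv)
qed

text \<open>The odd part vanishes at 0, so its quotient by z extends to an entire even function q,
  and the deformed derivative is f' + 2\<mu> q. Differentiation exchanges parities, and q
  contributes to the even part alone.\<close>

lemma deformed_deriv_parts:
  fixes \<mu> :: real
  assumes f: "f holomorphic_on UNIV"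
  obtains q where "q holomorphic_on UNIV" "odd_part f = (\<lambda>z. z * q z)"
    "deformed_deriv \<mu> f holomorphic_on UNIV"
    "odd_part (deformed_deriv \<mu> f) = deriv (even_part f)"
    "even_part (deformed_deriv \<mu> f) = (\<lambda>z. deriv (odd_part f) z + of_real (2 * \<mu>) * q z)"
proof
  let ?o = "odd_part f"
  define q where "q z = (if z = 0 then deriv ?o 0 else (?o z - ?o 0) / (z - 0))" for z
  show q: "q holomorphic_on UNIV"
    unfolding q_def by (intro pole_lemma_open holomorphic_parity_parts f) auto
  have o0: "?o 0 = 0" by (simp add: odd_part_def)
  show o: "?o = (\<lambda>z. z * q z)" by (auto simp: fun_eq_iff q_def o0)
  have q_even: "q (- z) = q z" for z
    by (auto simp: q_def o0 odd_part_def field_simps)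
  define E where "E z = deriv f z + of_real (2 * \<mu>) * q z" for z
  have E: "E holomorphic_on UNIV"
    unfolding E_def[abs_def] using f q by (intro holomorphic_intros) auto
  have "deformed_deriv \<mu> f z = E z" for z
    unfolding deformed_deriv_def
  proof (rule remove_sings_eqI, rule Lim_transform_eventually)
    show "E \<midarrow>z\<rightarrow> E z"
      using holomorphic_on_imp_continuous_on[OF E] by (simp add: continuous_on_eq_continuous_at isCont_def)
    \<comment> \<open>The limit is over a punctured neighbourhood, so w is eventually nonzero at
      every z, including z = 0.\<close>
    show "eventually (\<lambda>w. E w = deriv f w + of_real \<mu> / w * (f w - f (- w))) (at z)"
      using eventually_neq_at_within[of 0 z UNIV]
      by eventually_elim (auto simp: E_def q_def odd_part_def)
  qed
  then have DE: "deformed_deriv \<mu> f = E" by auto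
  show "deformed_deriv \<mu> f holomorphic_on UNIV" unfolding DE by (rule E)
  show "odd_part (deformed_deriv \<mu> f) = deriv (even_part f)"
    unfolding DE deriv_parity_parts[OF f] by (auto simp: fun_eq_iff odd_part_def E_def q_even)
  show "even_part (deformed_deriv \<mu> f) = (\<lambda>z. deriv (odd_part f) z + of_real (2 * \<mu>) * q z)"
    unfolding DE deriv_parity_parts[OF f] by (auto simp: fun_eq_iff even_part_def E_def q_even field_simps)
qed

lemma nn_integral_nu_Z2:
  assumes [measurable]: "G \<in> borel_measurable (lborel \<Otimes>\<^sub>M count_space {-1, 1})"
  shows "(\<integral>\<^sup>+x. G x \<partial>nu_Z2 \<mu>) = (\<integral>\<^sup>+z. G (z, 1) \<partial>nu_even \<mu>) + (\<integral>\<^sup>+z. G (z, -1) \<partial>nu_odd \<mu>)"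
proof -
  let ?d = "\<lambda>(z, s). ennreal (if s = (1::int) then nu_even_density \<mu> z else nu_odd_density \<mu> z)"
  have [measurable]: "?d \<in> borel_measurable (lborel \<Otimes>\<^sub>M count_space {-1, 1})"
    unfolding nu_even_density_eq nu_odd_density_eq by measurable
  have [measurable]: "(\<lambda>z. G (z, s)) \<in> borel_measurable borel" if "s \<in> {-1, 1}" for s
  proof -
    have "(\<lambda>z. (z, s)) \<in> lborel \<rightarrow>\<^sub>M lborel \<Otimes>\<^sub>M count_space {-1, 1}"
      using that by (intro measurable_Pair) auto
    from measurable_compose[OF this assms] show ?thesis by simp
  qed
  interpret C: sigma_finite_measure "count_space {-1, 1::int}"
    by (intro sigma_finite_measure_count_space_countable) auto
  have "(\<integral>\<^sup>+x. G x \<partial>nu_Z2 \<mu>) = (\<integral>\<^sup>+x. ?d x * G x \<partial>(lborel \<Otimes>\<^sub>M count_space {-1, 1}))"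
    unfolding nu_Z2_def by (rule nn_integral_density) measurable
  also have "\<dots> = (\<integral>\<^sup>+z. (\<integral>\<^sup>+s. ?d (z, s) * G (z, s) \<partial>count_space {-1, 1}) \<partial>lborel)"
    by (rule C.nn_integral_fst[symmetric]) measurable
  also have "\<dots> = (\<integral>\<^sup>+z. ennreal (nu_even_density \<mu> z) * G (z, 1) + ennreal (nu_odd_density \<mu> z) * G (z, -1) \<partial>lborel)"
    by (intro nn_integral_cong) (simp add: nn_integral_count_space_finite add.commute)
  also have "\<dots> = (\<integral>\<^sup>+z. G (z, 1) \<partial>nu_even \<mu>) + (\<integral>\<^sup>+z. G (z, -1) \<partial>nu_odd \<mu>)"
    unfolding nu_even_eq nu_odd_eq nu_even_density_eq nu_odd_density_eq
    by (simp add: nn_integral_nu_measure nn_integral_add)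
  finally show ?thesis .
qed

section \<open>Finiteness of energy and of entropy\<close>

context
  fixes \<mu> :: real
  assumes \<mu>: "\<mu> > - 1/2"
begin

lemma bargmann_space_iff:
  assumes f: "f holomorphic_on UNIV"
  shows "f \<in> bargmann_space \<mu> \<longleftrightarrow> (\<integral>\<^sup>+z. ennreal ((cmod (even_part f z))\<^sup>2) \<partial>nu_even \<mu>) < \<infinity>
    \<and> (\<integral>\<^sup>+z. ennreal ((cmod (odd_part f z))\<^sup>2) \<partial>nu_odd \<mu>) < \<infinity>"
  using f by (simp add: bargmann_space_def nu_even_eq nu_odd_eq in_L2_nu_measure_iff holomorphic_parity_parts)

lemma dirichlet_energy_finite_iff:
  assumes "f \<in> bargmann_space \<mu>"
  shows "\<bar>dirichlet_energy \<mu> f\<bar> \<noteq> \<infinity> \<longleftrightarrow>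
    (\<integral>\<^sup>+z. ennreal ((cmod (even_part f z))\<^sup>2 * ln ((cmod (even_part f z))\<^sup>2)) \<partial>nu_even \<mu>) < \<infinity> \<and>
    (\<integral>\<^sup>+z. ennreal ((cmod (odd_part f z))\<^sup>2 * ln ((cmod (odd_part f z))\<^sup>2)) \<partial>nu_odd \<mu>) < \<infinity>"
proof -
  have f: "f holomorphic_on UNIV" using assms by (simp add: bargmann_space_def)
  have fin: "(\<integral>\<^sup>+z. ennreal ((cmod (even_part f z))\<^sup>2) \<partial>nu_even \<mu>) < \<infinity>"
    "(\<integral>\<^sup>+z. ennreal ((cmod (odd_part f z))\<^sup>2) \<partial>nu_odd \<mu>) < \<infinity>"
    using assms bargmann_space_iff[OF f] by auto
  note hol = holomorphic_parity_parts[OF f]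
  note cont = hol[THEN holomorphic_on_imp_continuous_on]
  obtain q where q: "q holomorphic_on UNIV" "odd_part f = (\<lambda>z. z * q z)"
    and D: "deformed_deriv \<mu> f holomorphic_on UNIV"
    "odd_part (deformed_deriv \<mu> f) = deriv (even_part f)"
    "even_part (deformed_deriv \<mu> f) = (\<lambda>z. deriv (odd_part f) z + of_real (2 * \<mu>) * q z)"
    using deformed_deriv_parts[OF f, of \<mu>] by metis
  have "\<bar>dirichlet_energy \<mu> f\<bar> \<noteq> \<infinity> \<longleftrightarrow> deformed_deriv \<mu> f \<in> bargmann_space \<mu>"
    by (simp add: dirichlet_energy_def)
  \<comment> \<open>The even part of the deformed derivative comes from the odd part of f and
    conversely, so the conjuncts appear in reverse order until the final
    \<open>conj_commute\<close>.\<close>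
  also have "\<dots> \<longleftrightarrow>
      (\<integral>\<^sup>+z. ennreal ((cmod (deriv (odd_part f) z + of_real (2 * \<mu>) * q z))\<^sup>2) \<partial>nu_even \<mu>) < \<infinity> \<and>
      (\<integral>\<^sup>+z. ennreal ((cmod (deriv (even_part f) z))\<^sup>2) \<partial>nu_odd \<mu>) < \<infinity>"
    by (simp only: bargmann_space_iff[OF D(1)] D(2,3))
  also have "(\<integral>\<^sup>+z. ennreal ((cmod (deriv (even_part f) z))\<^sup>2) \<partial>nu_odd \<mu>) < \<infinity> \<longleftrightarrow>
      (\<integral>\<^sup>+z. ennreal ((cmod (z * even_part f z))\<^sup>2) \<partial>nu_odd \<mu>) < \<infinity>"
    unfolding dirichlet_identity_even[OF \<mu> hol(1)] using fin(1) by (simp add: ennreal_mult_less_top)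
  \<comment> \<open>The energy identity yields the weighted integral against the measure of the
    opposite parity; the entropy criterion needs the function's own measure.\<close>
  also have "\<dots> \<longleftrightarrow> (\<integral>\<^sup>+z. ennreal ((cmod (z * even_part f z))\<^sup>2) \<partial>nu_even \<mu>) < \<infinity>"
    unfolding nu_even_eq nu_odd_eq
    using weighted_L2_finite_transfer[OF \<mu> admissible(1)[OF \<mu>] cont(1)]
      weighted_L2_finite_transfer[OF \<mu> admissible(2)[OF \<mu>] cont(1)] by blast
  also have "\<dots> \<longleftrightarrow>
      (\<integral>\<^sup>+z. ennreal ((cmod (even_part f z))\<^sup>2 * ln ((cmod (even_part f z))\<^sup>2)) \<partial>nu_even \<mu>) < \<infinity>"
    using entropy_integral_finite_iff[OF \<mu> admissible(1)[OF \<mu>] hol(1)] fin(1) by (simp add: nu_even_eq)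
  also have "(\<integral>\<^sup>+z. ennreal ((cmod (deriv (odd_part f) z + of_real (2 * \<mu>) * q z))\<^sup>2) \<partial>nu_even \<mu>) < \<infinity> \<longleftrightarrow>
      (\<integral>\<^sup>+z. ennreal ((cmod (z * odd_part f z))\<^sup>2) \<partial>nu_even \<mu>) < \<infinity>"
  proof -
    \<comment> \<open>The corrections on both sides of the identity are finite, so finiteness of
      either side depends on its remaining term alone.\<close>
    have "2 * (\<integral>\<^sup>+z. ennreal ((cmod (odd_part f z))\<^sup>2) \<partial>nu_odd \<mu>) < \<infinity>"
      "ennreal (1 + 2 * \<mu>) * (\<integral>\<^sup>+z. ennreal ((cmod (odd_part f z))\<^sup>2) \<partial>nu_odd \<mu>) < \<infinity>"
      using fin(2) by (simp_all add: ennreal_mult_less_top)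
    then show ?thesis
      using arg_cong[OF dirichlet_identity_odd[OF \<mu> q], of "\<lambda>x. x < \<infinity>"] by simp
  qed
  also have "\<dots> \<longleftrightarrow> (\<integral>\<^sup>+z. ennreal ((cmod (z * odd_part f z))\<^sup>2) \<partial>nu_odd \<mu>) < \<infinity>"
    unfolding nu_even_eq nu_odd_eq
    using weighted_L2_finite_transfer[OF \<mu> admissible(1)[OF \<mu>] cont(2)]
      weighted_L2_finite_transfer[OF \<mu> admissible(2)[OF \<mu>] cont(2)] by blast
  also have "\<dots> \<longleftrightarrow>
      (\<integral>\<^sup>+z. ennreal ((cmod (odd_part f z))\<^sup>2 * ln ((cmod (odd_part f z))\<^sup>2)) \<partial>nu_odd \<mu>) < \<infinity>"
    using entropy_integral_finite_iff[OF \<mu> admissible(2)[OF \<mu>] hol(2)] fin(2) by (simp add: nu_odd_eq)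
  finally show ?thesis by (subst conj_commute)
qed

lemma emeasure_nu_finite:
  "emeasure (nu_even \<mu>) UNIV < \<infinity>" "emeasure (nu_odd \<mu>) UNIV < \<infinity>"
  unfolding nu_even_eq nu_odd_eq by (intro emeasure_nu_measure_finite \<mu> admissible)+

lemma emeasure_nu_Z2_finite: "emeasure (nu_Z2 \<mu>) (space (nu_Z2 \<mu>)) < \<infinity>"
  using nn_integral_nu_Z2[of "\<lambda>_. 1" \<mu>] emeasure_nu_finite
  by (simp add: nu_even_eq nu_odd_eq)

text \<open>The entropy itself is not a sum over parities because of its norm term, but the integral
  of the positive part is, and that integral alone decides finiteness.\<close>

lemma deformed_entropy_finite_iff:
  assumes f: "f holomorphic_on UNIV"
  shows "\<bar>deformed_entropy \<mu> f\<bar> \<noteq> \<infinity> \<longleftrightarrow>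
    (\<integral>\<^sup>+z. ennreal ((cmod (even_part f z))\<^sup>2 * ln ((cmod (even_part f z))\<^sup>2)) \<partial>nu_even \<mu>) < \<infinity> \<and>
    (\<integral>\<^sup>+z. ennreal ((cmod (odd_part f z))\<^sup>2 * ln ((cmod (odd_part f z))\<^sup>2)) \<partial>nu_odd \<mu>) < \<infinity>"
proof -
  have [measurable]: "even_part f \<in> borel_measurable borel" "odd_part f \<in> borel_measurable borel"
    by (intro borel_measurable_entire holomorphic_parity_parts f)+
  let ?F = "\<lambda>(z, s). if s = (1::int) then even_part f z else odd_part f z"
  have "?F \<in> borel_measurable (lborel \<Otimes>\<^sub>M count_space {-1, 1})" by measurable
  from measurable_compose[OF this, of "\<lambda>w. ennreal ((cmod w)\<^sup>2 * ln ((cmod w)\<^sup>2))" borel]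
  have meas: "(\<lambda>x. ennreal ((cmod (?F x))\<^sup>2 * ln ((cmod (?F x))\<^sup>2))) \<in> borel_measurable (lborel \<Otimes>\<^sub>M count_space {-1, 1})"
    by simp
  have "(\<integral>\<^sup>+x. ennreal ((cmod (?F x))\<^sup>2 * ln ((cmod (?F x))\<^sup>2)) \<partial>nu_Z2 \<mu>) =
    (\<integral>\<^sup>+z. ennreal ((cmod (even_part f z))\<^sup>2 * ln ((cmod (even_part f z))\<^sup>2)) \<partial>nu_even \<mu>) +
    (\<integral>\<^sup>+z. ennreal ((cmod (odd_part f z))\<^sup>2 * ln ((cmod (odd_part f z))\<^sup>2)) \<partial>nu_odd \<mu>)"
    unfolding nn_integral_nu_Z2[OF meas] by simp
  then show ?thesis
    unfolding deformed_entropy_def entropy_L2_finite_iff[OF emeasure_nu_Z2_finite] by simp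
qed

end

theorem corollary5p2:
  fixes \<mu> :: real
  assumes "\<mu> > - 1/2"
  shows "(\<forall>g \<in> bargmann_even \<mu>.
            \<bar>entropy_L2 (nu_even \<mu>) g\<bar> \<noteq> \<infinity> \<longleftrightarrow> \<bar>dirichlet_energy \<mu> g\<bar> \<noteq> \<infinity>)
       \<and> (\<forall>h \<in> bargmann_odd \<mu>.
            \<bar>entropy_L2 (nu_odd \<mu>) h\<bar> \<noteq> \<infinity> \<longleftrightarrow> \<bar>dirichlet_energy \<mu> h\<bar> \<noteq> \<infinity>)
       \<and> (\<forall>f \<in> bargmann_space \<mu>.
            \<bar>deformed_entropy \<mu> f\<bar> \<noteq> \<infinity> \<longleftrightarrow> \<bar>dirichlet_energy \<mu> f\<bar> \<noteq> \<infinity>)"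
proof (intro conjI ballI)
  fix g assume g: "g \<in> bargmann_even \<mu>"
  \<comment> \<open>The zero odd part has vanishing entropy integral, so only the even conjunct of
    \<open>dirichlet_energy_finite_iff\<close> carries content; the odd case below is
    symmetric.\<close>
  then have "even_part g = g" "odd_part g = (\<lambda>_. 0)"
    by (auto simp: bargmann_even_def even_part_def odd_part_def fun_eq_iff)
  with g show "\<bar>entropy_L2 (nu_even \<mu>) g\<bar> \<noteq> \<infinity> \<longleftrightarrow> \<bar>dirichlet_energy \<mu> g\<bar> \<noteq> \<infinity>"
    using dirichlet_energy_finite_iff[OF assms, of g] emeasure_nu_finite(1)[OF assms]
    by (simp add: bargmann_even_def entropy_L2_finite_iff nu_even_eq)
next
  fix h assume h: "h \<in> bargmann_odd \<mu>"
  then have "even_part h = (\<lambda>_. 0)" "odd_part h = h"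
    by (auto simp: bargmann_odd_def even_part_def odd_part_def fun_eq_iff)
  with h show "\<bar>entropy_L2 (nu_odd \<mu>) h\<bar> \<noteq> \<infinity> \<longleftrightarrow> \<bar>dirichlet_energy \<mu> h\<bar> \<noteq> \<infinity>"
    using dirichlet_energy_finite_iff[OF assms, of h] emeasure_nu_finite(2)[OF assms]
    by (simp add: bargmann_odd_def entropy_L2_finite_iff nu_odd_eq)
next
  fix f assume f: "f \<in> bargmann_space \<mu>"
  then have "f holomorphic_on UNIV" by (simp add: bargmann_space_def)
  with f show "\<bar>deformed_entropy \<mu> f\<bar> \<noteq> \<infinity> \<longleftrightarrow> \<bar>dirichlet_energy \<mu> f\<bar> \<noteq> \<infinity>"
    by (simp add: deformed_entropy_finite_iff[OF assms] dirichlet_energy_finite_iff[OF assms])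
qed

end
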